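(* Consider the two-dimensional DG scheme with Euler forward time discretization described in the context. Suppose $r^n>0$ (hence $c^n>0$), and suppose $\alpha$ and $\tilde\alpha$ satisfy $$\alpha>\max_{1\le i\le N_x-1,\ 1\le j\le N_y-1,\ \beta=1,2}\{(u_1)^+_{i+\frac12,j,\beta},(u_2)^+_{i,j+\frac12,\beta},0\},$$ $$\tilde\alpha\ge\frac{\Delta y}{2\Delta x}D_{11}^M+\sqrt3D_{12}^M,\qquad \tilde\alpha\ge\frac{\Delta x}{2\Delta y}D_{22}^M+\sqrt3D_{21}^M.$$ Assume the conditions $$\frac{\Delta t}{\Delta x}+\frac{\Delta t}{\Delta y}\le\frac16\min\left\{\frac{\Phi_m}{\alpha},B_1,B_2\right\},$$ $$D_{11}^M\Lambda_1+2(\tilde\alpha+D_{12}^M)\lambda\le\frac1{12}\Phi_m,\qquad D_{22}^M\Lambda_2+2(\tilde\alpha+D_{21}^M)\lambda\le\frac1{12}\Phi_m,$$ $$\Delta t\le\frac1{6z_1p_M},\qquad \Delta t\le\min_{i,j}\frac{\Phi^m_{ij}}{6\max_{\beta,\gamma}\{-q(x_i^\beta,y_j^\gamma),0\}}.$$ Then $\bar r_{ij}^{n+1}>0$ for all cells $K_{ij}$ away from $\partial\Omega$ (i.e. $2\le i\le N_x-1$, $2\le j\le N_y-1$).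
   Context: Mesh and spaces. $\Omega=[0,2\pi]^2$ is partitioned uniformly into rectangles $K_{ij}=I_i\times J_j$, $I_i=(x_{i-\frac12},x_{i+\frac12})$, $J_j=(y_{j-\frac12},y_{j+\frac12})$, $1\le i\le N_x$, $1\le j\le N_y$, with side lengths $\Delta x,\Delta y$. $W_h$ is the space of functions whose restriction to each cell is in $Q^1$ (tensor products of linear polynomials), ${\bf W}_h=W_h\times W_h$. $\Gamma$ is the set of cell interfaces (edges), $\Gamma_0=\Gamma\setminus\partial\Omega$; $|e|$ is the length of $e$. ${\bf n}_e=(1,0)$ on vertical edges, $(0,1)$ on horizontal edges. On an interior edge, $v^-$ is the trace from the left (resp. lower) cell, $v^+$ from the right (resp. upper) cell; $[v]=v^+-v^-$, $\{v\}=\frac12(v^++v^-)$. Traces from outside $\Omega$ are set to $0$. $\partial\Omega_+$ is the right and top part of $\partial\Omega$, $\partial\Omega_-$ the left and bottom part. $\bar v_{ij}$ is the average of $v$ over $K_{ij}$. $(v,w)=\int_\Omega vw\,dxdy$. The 2-point Gauss points on $I_i$, $J_j$ are $x_i^1,x_i^2$, $y_j^1,y_j^2$; a third subscript $\beta$ denotes evaluation at the corresponding Gauss point of an edge, e.g. $v^\pm_{i+\frac12,j,\beta}=v^\pm(x_{i+\frac12},y_j^\beta)$, $v^\pm_{i,j+\frac12,\beta}=v^\pm(x_i^\beta,y_{j+\frac12})$. Data. $\phi>0$ is the porosity; $\Phi\in W_h$ is the continuous interpolant equal to $\phi$ at the cell corners, $\Phi_{i+\frac12,j+\frac12}=\phi(x_{i+\frac12},y_{j+\frac12})$.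 For a function $g$, $\mathcal I_1 g\in W_h$ is the cellwise $Q^1$ interpolant at the four corners of each cell (using values from within the cell). $z_1,z_2>0$ are compressibility factors; $a(c)=\mu(c)/\kappa$ ($\mu$ viscosity, $\kappa$ permeability); $q$ is the external flow rate; $\tilde c\in[0,1]$ is the concentration in the external flow, equal to the numerical $c$ at points where $q<0$. ${\bf D}({\bf u})$ is a symmetric positive semidefinite $2\times2$ matrix with entries $D_{k\ell}$. $\alpha,\tilde\alpha$ are positive constants. $c=\mathcal I_1\{r/\Phi\}$, $\tilde d(r)=z_1r+z_2(\Phi-r)$. Scheme. $p,r\in W_h$, ${\bf u}=(u_1,u_2)\in{\bf W}_h$ such that for all $\xi,\zeta\in W_h$, $\boldsymbol\eta\in{\bf W}_h$: $$(\tilde d(r)p_t,\xi)=({\bf u},\nabla\xi)+\sum_{e\in\Gamma_0}\int_e\hat{\bf u}[\xi]\cdot{\bf n}_e\,ds+(q,\xi),$$ $$(a(c){\bf u},\boldsymbol\eta)=(p,\nabla\cdot\boldsymbol\eta)+\sum_{e\in\Gamma}\int_e\hat p[\boldsymbol\eta\cdot{\bf n}_e]\,ds,$$ $$(r_t,\zeta)=({\bf u}c-{\bf D}({\bf u})\nabla c,\nabla\zeta)+(\tilde cq-rz_1p_t,\zeta)+\sum_{e\in\Gamma_0}\int_e\widehat{{\bf u}c}\cdot{\bf n}_e[\zeta]\,ds-\sum_{e\in\Gamma_0}\int_e\Big(\{{\bf D}({\bf u})\nabla c\cdot{\bf n}_e\}[\zeta]+\{{\bf D}({\bf u})\nabla\zeta\cdot{\bf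 n}_e\}[c]+\frac{\tilde\alpha}{|e|}[c][\zeta]\Big)ds,$$ with, on $\Gamma_0$, $\hat{\bf u}={\bf u}^+$, $\hat p=p^-$, and (componentwise normal flux) $\widehat{u_kc}=u_k^+c^+-\alpha[c]$, $k=1,2$ ($k=1$ on vertical, $k=2$ on horizontal edges); on $\partial\Omega$, $\hat{\bf u}=0$, $\hat p=p^-$ on $\partial\Omega_+$ and $\hat p=p^+$ on $\partial\Omega_-$. Edge integrals and source integrals over cells are evaluated by (tensor-product) 2-point Gaussian quadrature. Euler forward: all quantities are at time level $n$ (superscript omitted), $p_t\in W_h$ satisfies the first equation, and $r^{n+1}\in W_h$ is given by the third with $r_t=(r^{n+1}-r^n)/\Delta t$, $\Delta t>0$. Notation. $\lambda=\frac{\Delta t}{\Delta x\Delta y}$, $\Lambda_1=\frac{\Delta t}{\Delta x^2}$, $\Lambda_2=\frac{\Delta t}{\Delta y^2}$. $\Phi_m=\min_{0\le i\le N_x,0\le j\le N_y}\Phi_{i+\frac12,j+\frac12}$; $\Phi^m_{ij}$ is the minimum of $\Phi$ over the four corners of $K_{ij}$. $$B_1=\min_{1\le i\le N_x-1,\,1\le j\le N_y,\,\beta=1,2}\frac{\Phi_{i+\frac12,j\pm\frac12}}{\alpha-(u_1)^+_{i+\frac12,j,\beta}},\qquad B_2=\min_{1\le i\le N_x,\,1\le j\le N_y-1,\,\beta=1,2}\frac{\Phi_{i\pm\frac12,j+\frac12}}{\alpha-(u_2)^+_{i,j+\frac12,\beta}}$$ (minimum also over both signs). $D_{kk}^M=\max_\Omega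 D_{kk}({\bf u})$, $D_{12}^M=\max_\Omega|D_{12}({\bf u})|$, $D_{21}^M=\max_\Omega|D_{21}({\bf u})|$, where maxima include one-sided traces on cell edges. $p_M=\max\{p_t(x_i^\beta,y_j^\gamma),0\}$, maximum over all $i,j$ and $\beta,\gamma\in\{1,2\}$. $r^n>0$ means positivity on every closed cell (including traces). A fraction with zero denominator is interpreted as $+\infty$. *)

theory Defs
  imports "HOL-Analysis.Analysis"
begin

(* The domain [0, 2 pi]^2 carries the uniform Nx x Ny mesh.  All one-dimensional mesh quantities
   are given for a partition of [0, 2 pi] into N intervals I_1, ..., I_N; node N i stands for the
   half-index point x_{i+1/2}, so I_i = (node N (i - 1), node N i). *)

definition Omega :: "(real \<times> real) set" where
  "Omega = {0..2 * pi} \<times> {0..2 * pi}"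

definition step :: "nat \<Rightarrow> real" where
  "step N = 2 * pi / real N"

definition node :: "nat \<Rightarrow> nat \<Rightarrow> real" where
  "node N i = real i * step N"

(* The two Gauss points of I_i, b = 1, 2; both quadrature weights are (step N) / 2. *)
definition gauss :: "nat \<Rightarrow> nat \<Rightarrow> nat \<Rightarrow> real" where
  "gauss N i b = (real i - 1 / 2) * step N + (if b = 1 then - 1 else 1) * step N / (2 * sqrt 3)"

definition cell :: "nat \<Rightarrow> nat \<Rightarrow> nat \<Rightarrow> nat \<Rightarrow> (real \<times> real) set" where
  "cell Nx Ny i j = {node Nx (i - 1)..node Nx i} \<times> {node Ny (j - 1)..node Ny j}"

(* A piecewise defined, possibly discontinuous function v is represented by the family of its
   restrictions: v i j is the restriction to K_ij together with its extension to the closed cell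
   (for polynomials, to the whole plane).  One-sided traces on edges are then evaluations of the
   member that belongs to the cell in question. *)
type_synonym 'a cellfun = "nat \<Rightarrow> nat \<Rightarrow> real \<times> real \<Rightarrow> 'a"

definition Wh :: "nat \<Rightarrow> nat \<Rightarrow> real cellfun set" where
  "Wh Nx Ny = {v. \<forall>i\<in>{1..Nx}. \<forall>j\<in>{1..Ny}.
     \<exists>a b c d. \<forall>x y. v i j (x, y) = a + b * x + c * y + d * x * y}"

definition WWh :: "nat \<Rightarrow> nat \<Rightarrow> (real ^ 2) cellfun set" where
  "WWh Nx Ny = {v. \<forall>k. (\<lambda>i j z. v i j z $ k) \<in> Wh Nx Ny}"

definition cell_avg :: "nat \<Rightarrow> nat \<Rightarrow> real cellfun \<Rightarrow> nat \<Rightarrow> nat \<Rightarrow> real" where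
  "cell_avg Nx Ny v i j = integral (cell Nx Ny i j) (v i j) / (step Nx * step Ny)"

definition interp :: "nat \<Rightarrow> nat \<Rightarrow> real cellfun \<Rightarrow> real cellfun" where
  "interp Nx Ny g i j z =
    (let xl = node Nx (i - 1); xr = node Nx i; yl = node Ny (j - 1); yr = node Ny j;
         s = (fst z - xl) / (xr - xl); t = (snd z - yl) / (yr - yl)
     in (1 - s) * (1 - t) * g i j (xl, yl) + s * (1 - t) * g i j (xr, yl)
        + (1 - s) * t * g i j (xl, yr) + s * t * g i j (xr, yr))"

definition Phi_h :: "nat \<Rightarrow> nat \<Rightarrow> (real \<times> real \<Rightarrow> real) \<Rightarrow> real cellfun" where
  "Phi_h Nx Ny \<phi> = interp Nx Ny (\<lambda>i j. \<phi>)"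

definition conc :: "nat \<Rightarrow> nat \<Rightarrow> (real \<times> real \<Rightarrow> real) \<Rightarrow> real cellfun \<Rightarrow> real cellfun" where
  "conc Nx Ny \<phi> r = interp Nx Ny (\<lambda>i j z. r i j z / Phi_h Nx Ny \<phi> i j z)"

definition dtilde :: "nat \<Rightarrow> nat \<Rightarrow> (real \<times> real \<Rightarrow> real) \<Rightarrow> real \<Rightarrow> real \<Rightarrow> real cellfun \<Rightarrow> real cellfun" where
  "dtilde Nx Ny \<phi> z1 z2 r i j z = z1 * r i j z + z2 * (Phi_h Nx Ny \<phi> i j z - r i j z)"

definition grad :: "real cellfun \<Rightarrow> (real ^ 2) cellfun" where
  "grad v i j z = vector [deriv (\<lambda>x. v i j (x, snd z)) (fst z), deriv (\<lambda>y. v i j (fst z, y)) (snd z)]"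

definition divg :: "(real ^ 2) cellfun \<Rightarrow> real cellfun" where
  "divg v i j z = deriv (\<lambda>x. v i j (x, snd z) $ 1) (fst z) + deriv (\<lambda>y. v i j (fst z, y) $ 2) (snd z)"

(* The exact L2 product (v, w) over the domain, for scalar and for vector functions. *)
definition ip :: "nat \<Rightarrow> nat \<Rightarrow> ('a::real_inner) cellfun \<Rightarrow> 'a cellfun \<Rightarrow> real" where
  "ip Nx Ny v w = (\<Sum>i=1..Nx. \<Sum>j=1..Ny. integral (cell Nx Ny i j) (\<lambda>z. v i j z \<bullet> w i j z))"

(* The same product with tensor-product 2-point Gauss quadrature, used for source terms. *)
definition ip_gauss :: "nat \<Rightarrow> nat \<Rightarrow> real cellfun \<Rightarrow> real cellfun \<Rightarrow> real" where
  "ip_gauss Nx Ny v w = (\<Sum>i=1..Nx. \<Sum>j=1..Ny. step Nx * step Ny / 4 *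
     (\<Sum>b\<in>{1, 2}. \<Sum>g\<in>{1, 2}. v i j (gauss Nx i b, gauss Ny j g) * w i j (gauss Nx i b, gauss Ny j g)))"

(* Vert i j is the edge {x_{i+1/2}} x J_j, and Horiz i j is the edge I_i x {y_{j+1/2}}. *)
datatype edge = Vert nat nat | Horiz nat nat

definition edges :: "nat \<Rightarrow> nat \<Rightarrow> edge set" where
  "edges Nx Ny = {Vert i j | i j. i \<in> {0..Nx} \<and> j \<in> {1..Ny}}
     \<union> {Horiz i j | i j. i \<in> {1..Nx} \<and> j \<in> {0..Ny}}"

definition bdry_plus :: "nat \<Rightarrow> nat \<Rightarrow> edge set" where
  "bdry_plus Nx Ny = {Vert Nx j | j. j \<in> {1..Ny}} \<union> {Horiz i Ny | i. i \<in> {1..Nx}}"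

definition bdry_minus :: "nat \<Rightarrow> nat \<Rightarrow> edge set" where
  "bdry_minus Nx Ny = {Vert 0 j | j. j \<in> {1..Ny}} \<union> {Horiz i 0 | i. i \<in> {1..Nx}}"

definition edges0 :: "nat \<Rightarrow> nat \<Rightarrow> edge set" where
  "edges0 Nx Ny = edges Nx Ny - (bdry_plus Nx Ny \<union> bdry_minus Nx Ny)"

fun normal :: "edge \<Rightarrow> real ^ 2" where
  "normal (Vert i j) = axis 1 1"
| "normal (Horiz i j) = axis 2 1"

fun len :: "nat \<Rightarrow> nat \<Rightarrow> edge \<Rightarrow> real" where
  "len Nx Ny (Vert i j) = step Ny"
| "len Nx Ny (Horiz i j) = step Nx"

fun edge_pt :: "nat \<Rightarrow> nat \<Rightarrow> edge \<Rightarrow> nat \<Rightarrow> real \<times> real" where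
  "edge_pt Nx Ny (Vert i j) b = (node Nx i, gauss Ny j b)"
| "edge_pt Nx Ny (Horiz i j) b = (gauss Nx i b, node Ny j)"

definition edge_quad :: "nat \<Rightarrow> nat \<Rightarrow> edge \<Rightarrow> (real \<times> real \<Rightarrow> real) \<Rightarrow> real" where
  "edge_quad Nx Ny e f = len Nx Ny e / 2 * (\<Sum>b\<in>{1, 2}. f (edge_pt Nx Ny e b))"

(* Traces on an edge from the left/lower cell (tr_minus) and from the right/upper cell (tr_plus);
   traces from outside the domain are 0. *)
fun tr_minus :: "('a::zero) cellfun \<Rightarrow> edge \<Rightarrow> real \<times> real \<Rightarrow> 'a" where
  "tr_minus v (Vert i j) z = (if i = 0 then 0 else v i j z)"
| "tr_minus v (Horiz i j) z = (if j = 0 then 0 else v i j z)"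

fun tr_plus :: "nat \<Rightarrow> nat \<Rightarrow> ('a::zero) cellfun \<Rightarrow> edge \<Rightarrow> real \<times> real \<Rightarrow> 'a" where
  "tr_plus Nx Ny v (Vert i j) z = (if i = Nx then 0 else v (i + 1) j z)"
| "tr_plus Nx Ny v (Horiz i j) z = (if j = Ny then 0 else v i (j + 1) z)"

definition jump :: "nat \<Rightarrow> nat \<Rightarrow> real cellfun \<Rightarrow> edge \<Rightarrow> real \<times> real \<Rightarrow> real" where
  "jump Nx Ny v e z = tr_plus Nx Ny v e z - tr_minus v e z"

definition avg :: "nat \<Rightarrow> nat \<Rightarrow> real cellfun \<Rightarrow> edge \<Rightarrow> real \<times> real \<Rightarrow> real" where
  "avg Nx Ny v e z = (tr_plus Nx Ny v e z + tr_minus v e z) / 2"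

definition p_hat :: "nat \<Rightarrow> nat \<Rightarrow> real cellfun \<Rightarrow> edge \<Rightarrow> real \<times> real \<Rightarrow> real" where
  "p_hat Nx Ny p e z = (if e \<in> bdry_minus Nx Ny then tr_plus Nx Ny p e z else tr_minus p e z)"

definition uc_hat ::
  "nat \<Rightarrow> nat \<Rightarrow> real \<Rightarrow> (real ^ 2) cellfun \<Rightarrow> real cellfun \<Rightarrow> edge \<Rightarrow> real \<times> real \<Rightarrow> real ^ 2" where
  "uc_hat Nx Ny \<alpha> u c e z =
     (\<chi> k. tr_plus Nx Ny u e z $ k * tr_plus Nx Ny c e z - \<alpha> * jump Nx Ny c e z)"

definition pressure_eq ::
  "nat \<Rightarrow> nat \<Rightarrow> (real \<times> real \<Rightarrow> real) \<Rightarrow> real \<Rightarrow> real \<Rightarrow> (real \<times> real \<Rightarrow> real) \<Rightarrow>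
   real cellfun \<Rightarrow> (real ^ 2) cellfun \<Rightarrow> real cellfun \<Rightarrow> bool" where
  "pressure_eq Nx Ny \<phi> z1 z2 q r u pt \<longleftrightarrow> (\<forall>\<xi>\<in>Wh Nx Ny.
     ip Nx Ny (\<lambda>i j z. dtilde Nx Ny \<phi> z1 z2 r i j z * pt i j z) \<xi>
     = ip Nx Ny u (grad \<xi>)
       + (\<Sum>e\<in>edges0 Nx Ny. edge_quad Nx Ny e
            (\<lambda>z. (jump Nx Ny \<xi> e z *\<^sub>R tr_plus Nx Ny u e z) \<bullet> normal e))
       + ip_gauss Nx Ny (\<lambda>i j. q) \<xi>)"

definition velocity_eq ::
  "nat \<Rightarrow> nat \<Rightarrow> (real \<Rightarrow> real) \<Rightarrow> (real \<times> real \<Rightarrow> real) \<Rightarrow>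
   real cellfun \<Rightarrow> real cellfun \<Rightarrow> (real ^ 2) cellfun \<Rightarrow> bool" where
  "velocity_eq Nx Ny \<mu> \<kappa> c p u \<longleftrightarrow> (\<forall>\<eta>\<in>WWh Nx Ny.
     ip Nx Ny (\<lambda>i j z. (\<mu> (c i j z) / \<kappa> z) *\<^sub>R u i j z) \<eta>
     = ip Nx Ny p (divg \<eta>)
       + (\<Sum>e\<in>edges Nx Ny. edge_quad Nx Ny e
            (\<lambda>z. p_hat Nx Ny p e z * jump Nx Ny (\<lambda>i j z. \<eta> i j z \<bullet> normal e) e z)))"

(* The piecewise function D(u) grad v; the matrix field D may also depend on the position. *)
definition diff_flux ::
  "(real \<times> real \<Rightarrow> real ^ 2 \<Rightarrow> real ^ 2 ^ 2) \<Rightarrow> (real ^ 2) cellfun \<Rightarrow> real cellfun \<Rightarrow> (real ^ 2) cellfun" where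
  "diff_flux D u v i j z = D z (u i j z) *v grad v i j z"

definition conc_eq ::
  "nat \<Rightarrow> nat \<Rightarrow> real \<Rightarrow> (real \<times> real \<Rightarrow> real) \<Rightarrow> (real \<times> real \<Rightarrow> real) \<Rightarrow>
   (real \<times> real \<Rightarrow> real ^ 2 \<Rightarrow> real ^ 2 ^ 2) \<Rightarrow> real \<Rightarrow> real \<Rightarrow>
   real cellfun \<Rightarrow> real cellfun \<Rightarrow> (real ^ 2) cellfun \<Rightarrow> real cellfun \<Rightarrow> real cellfun \<Rightarrow> bool" where
  "conc_eq Nx Ny z1 q ct D \<alpha> \<alpha>' r c u pt rt \<longleftrightarrow> (\<forall>\<zeta>\<in>Wh Nx Ny.
     ip Nx Ny rt \<zeta>
     = ip Nx Ny (\<lambda>i j z. c i j z *\<^sub>R u i j z - diff_flux D u c i j z) (grad \<zeta>)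
       + ip_gauss Nx Ny (\<lambda>i j z. ct z * q z - r i j z * z1 * pt i j z) \<zeta>
       + (\<Sum>e\<in>edges0 Nx Ny. edge_quad Nx Ny e
            (\<lambda>z. (uc_hat Nx Ny \<alpha> u c e z \<bullet> normal e) * jump Nx Ny \<zeta> e z))
       - (\<Sum>e\<in>edges0 Nx Ny. edge_quad Nx Ny e
            (\<lambda>z. avg Nx Ny (\<lambda>i j z. diff_flux D u c i j z \<bullet> normal e) e z * jump Nx Ny \<zeta> e z
                + avg Nx Ny (\<lambda>i j z. diff_flux D u \<zeta> i j z \<bullet> normal e) e z * jump Nx Ny c e z
                + \<alpha>' / len Nx Ny e * jump Nx Ny c e z * jump Nx Ny \<zeta> e z)))"

(* The corner value of Phi_h at (x_{i+1/2}, y_{j+1/2}). *)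
definition Phi_node :: "nat \<Rightarrow> nat \<Rightarrow> (real \<times> real \<Rightarrow> real) \<Rightarrow> nat \<Rightarrow> nat \<Rightarrow> real" where
  "Phi_node Nx Ny \<phi> i j = \<phi> (node Nx i, node Ny j)"

definition Phi_min :: "nat \<Rightarrow> nat \<Rightarrow> (real \<times> real \<Rightarrow> real) \<Rightarrow> real" where
  "Phi_min Nx Ny \<phi> = Min {Phi_node Nx Ny \<phi> i j | i j. i \<in> {0..Nx} \<and> j \<in> {0..Ny}}"

definition Phi_cell_min :: "nat \<Rightarrow> nat \<Rightarrow> (real \<times> real \<Rightarrow> real) \<Rightarrow> nat \<Rightarrow> nat \<Rightarrow> real" where
  "Phi_cell_min Nx Ny \<phi> i j = Min {Phi_node Nx Ny \<phi> k l | k l. k \<in> {i - 1, i} \<and> l \<in> {j - 1, j}}"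

(* Normal velocities (u_1)^+ and (u_2)^+ at the Gauss points of interior edges. *)
definition u1_plus :: "nat \<Rightarrow> nat \<Rightarrow> (real ^ 2) cellfun \<Rightarrow> nat \<Rightarrow> nat \<Rightarrow> nat \<Rightarrow> real" where
  "u1_plus Nx Ny u i j b = tr_plus Nx Ny u (Vert i j) (edge_pt Nx Ny (Vert i j) b) $ 1"

definition u2_plus :: "nat \<Rightarrow> nat \<Rightarrow> (real ^ 2) cellfun \<Rightarrow> nat \<Rightarrow> nat \<Rightarrow> nat \<Rightarrow> real" where
  "u2_plus Nx Ny u i j b = tr_plus Nx Ny u (Horiz i j) (edge_pt Nx Ny (Horiz i j) b) $ 2"

(* The quotients below are formed in ereal, where a / 0 = \<infinity> for a > 0, and an infimum over an
   empty index set is \<infinity>. *)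
definition B1 :: "nat \<Rightarrow> nat \<Rightarrow> (real \<times> real \<Rightarrow> real) \<Rightarrow> real \<Rightarrow> (real ^ 2) cellfun \<Rightarrow> ereal" where
  "B1 Nx Ny \<phi> \<alpha> u = (INF i\<in>{1..Nx - 1}. INF j\<in>{1..Ny}. INF b\<in>{1, 2}. INF l\<in>{j - 1, j}.
     ereal (Phi_node Nx Ny \<phi> i l) / ereal (\<alpha> - u1_plus Nx Ny u i j b))"

definition B2 :: "nat \<Rightarrow> nat \<Rightarrow> (real \<times> real \<Rightarrow> real) \<Rightarrow> real \<Rightarrow> (real ^ 2) cellfun \<Rightarrow> ereal" where
  "B2 Nx Ny \<phi> \<alpha> u = (INF i\<in>{1..Nx}. INF j\<in>{1..Ny - 1}. INF b\<in>{1, 2}. INF k\<in>{i - 1, i}.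
     ereal (Phi_node Nx Ny \<phi> k j) / ereal (\<alpha> - u2_plus Nx Ny u i j b))"

(* Suprema over the closed cells, hence over all one-sided traces; \<infinity> if the entry is unbounded. *)
definition D_diag_max ::
  "nat \<Rightarrow> nat \<Rightarrow> (real \<times> real \<Rightarrow> real ^ 2 \<Rightarrow> real ^ 2 ^ 2) \<Rightarrow> (real ^ 2) cellfun \<Rightarrow> 2 \<Rightarrow> ereal" where
  "D_diag_max Nx Ny D u k = (SUP i\<in>{1..Nx}. SUP j\<in>{1..Ny}. SUP z\<in>cell Nx Ny i j.
     ereal (D z (u i j z) $ k $ k))"

definition D_off_max ::
  "nat \<Rightarrow> nat \<Rightarrow> (real \<times> real \<Rightarrow> real ^ 2 \<Rightarrow> real ^ 2 ^ 2) \<Rightarrow> (real ^ 2) cellfun \<Rightarrow> 2 \<Rightarrow> 2 \<Rightarrow> ereal" where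
  "D_off_max Nx Ny D u k l = (SUP i\<in>{1..Nx}. SUP j\<in>{1..Ny}. SUP z\<in>cell Nx Ny i j.
     ereal \<bar>D z (u i j z) $ k $ l\<bar>)"

definition p_max :: "nat \<Rightarrow> nat \<Rightarrow> real cellfun \<Rightarrow> real" where
  "p_max Nx Ny pt = Max (insert 0 {pt i j (gauss Nx i b, gauss Ny j g) | i j b g.
     i \<in> {1..Nx} \<and> j \<in> {1..Ny} \<and> b \<in> {1, 2} \<and> g \<in> {1, 2}})"

definition q_neg_max :: "nat \<Rightarrow> nat \<Rightarrow> (real \<times> real \<Rightarrow> real) \<Rightarrow> nat \<Rightarrow> nat \<Rightarrow> real" where
  "q_neg_max Nx Ny q i j = Max (insert 0 {- q (gauss Nx i b, gauss Ny j g) | b g.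
     b \<in> {1, 2} \<and> g \<in> {1, 2}})"

end

theory Submission
  imports Defs
begin

text \<open>
  Testing the concentration equation with the indicator of one cell \<open>K\<close> turns the scheme into a
  balance for the mean value \<open>A\<close> of \<open>r\<close> over \<open>K\<close>: in one time step the mean changes by the source and by
  the numerical fluxes through the four edges (\<open>cell_balance\<close>). Through an edge, a flux is a
  combination of concentration values in \<open>K\<close> and values in the neighbouring cell. The lower bounds on
  \<open>\<alpha>\<close> and \<open>\<alpha>'\<close> are made so that the contribution of the neighbour is an inflow: \<open>\<alpha>\<close> dominates the normal
  velocity, and the penalty dominates the outer part of the averaged diffusive flux. What can be lost
  therefore depends on the values in \<open>K\<close> alone, and \<open>outflow_bound\<close> bounds it by a nonnegative
  combination of the concentrations at the Gauss points of the edge and of the opposite edge.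
  
  It remains to measure this loss against \<open>A\<close>. For a function in \<open>Q\<^sup>1\<close> the mean value is a quarter of the
  sum of its values at the four Gauss points of any two opposite edges, and likewise of its values at
  the four interior Gauss points (\<open>Wh_cell_avg\<close>). Since \<open>c\<close> interpolates \<open>r / \<Phi>\<close> at the corners,
  \<open>m * c \<le> r\<close> holds wherever \<open>m\<close> is at most the corner values of \<open>\<Phi>\<close> involved
  (\<open>scaled_conc_le_vert\<close>, \<open>scaled_conc_le_horiz\<close>, \<open>scaled_conc_le_cell\<close>). With these comparisons the
  time step restrictions say that convection costs at most \<open>A / 3\<close>, diffusion \<open>A / 12\<close> per direction,
  and compressibility and sinks \<open>A / 6\<close> each. At least \<open>A / 6\<close> is left, and \<open>A > 0\<close>.
\<close>

section \<open>The mesh\<close>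

declare One_nat_def [simp del]

lemma sum_gauss_points: "(\<Sum>b\<in>{1, 2}. f b) = f 1 + f (2::nat)"
  by simp

lemma step_pos: "N \<ge> 1 \<Longrightarrow> 0 < step N"
  by (simp add: step_def)

lemma node_pred: "i \<ge> 1 \<Longrightarrow> node N (i - 1) = node N i - step N"
  by (simp add: node_def of_nat_diff algebra_simps)

lemma gauss_symmetric:
  assumes "i \<ge> 1"
  shows "gauss N i 1 + gauss N i 2 = node N (i - 1) + node N i"
  unfolding node_pred[OF assms] by (simp add: gauss_def node_def algebra_simps)

lemma gauss_in_interval:
  assumes "N \<ge> 1" "i \<ge> 1"
  shows "node N (i - 1) < gauss N i b" "gauss N i b < node N i"
proof -
  define h where "h = step N / (2 * sqrt 3)"
  have "1 < sqrt 3" by simp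
  then have h: "0 < h" "h < step N / 2"
    using step_pos[OF assms(1)] by (simp_all add: h_def field_simps)
  have g: "gauss N i b = node N i - step N / 2 + (if b = 1 then - h else h)"
    by (simp add: gauss_def node_def h_def algebra_simps)
  then show "node N (i - 1) < gauss N i b" "gauss N i b < node N i"
    using h unfolding node_pred[OF assms(2)] g by auto
qed

lemma node_bounds:
  assumes "N \<ge> 1" "i \<le> N"
  shows "0 \<le> node N i" "node N i \<le> 2 * pi"
  using assms by (auto simp: node_def step_def field_simps)

lemma cell_subset_Omega:
  assumes "i \<in> {1..Nx}" "j \<in> {1..Ny}"
  shows "cell Nx Ny i j \<subseteq> Omega"
proof -
  have "0 \<le> node Nx (i - 1)" "node Nx i \<le> 2 * pi" "0 \<le> node Ny (j - 1)" "node Ny j \<le> 2 * pi"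
    using assms by (auto intro!: node_bounds)
  then show ?thesis
    unfolding cell_def Omega_def by (intro Sigma_mono) simp_all
qed

lemma node_in_interval:
  assumes "N \<ge> 1" "i \<ge> 1" "k \<in> {i - 1, i}"
  shows "node N (i - 1) \<le> node N k" "node N k \<le> node N i"
  using assms step_pos[of N] node_pred[of i N] by auto

section \<open>Bilinear functions on a cell\<close>

lemma Wh_bilinear:
  assumes "v \<in> Wh Nx Ny" "i \<in> {1..Nx}" "j \<in> {1..Ny}"
  obtains a b c d where "\<And>x y. v i j (x, y) = a + b * x + c * y + d * x * y"
  using assms unfolding Wh_def by blast

text \<open>
  On a horizontal line a function in \<open>Q\<^sup>1\<close> is affine, so the sum of two of its values depends only on the
  midpoint. This single fact replaces the exactness of the Gauss, midpoint and trapezoidal rules: the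
  pairs of Gauss points and of end points of an interval have the same midpoint.
\<close>

lemma Wh_exchange_x:
  assumes "v \<in> Wh Nx Ny" "i \<in> {1..Nx}" "j \<in> {1..Ny}" "x1 + x2 = x3 + x4"
  shows "v i j (x1, y) + v i j (x2, y) = v i j (x3, y) + v i j (x4, y)"
proof -
  obtain a b c d where v: "\<And>x y. v i j (x, y) = a + b * x + c * y + d * x * y"
    using Wh_bilinear[OF assms(1-3)] by blast
  have "v i j (x, y) + v i j (x', y) = 2 * (a + c * y) + (b + d * y) * (x + x')" for x x'
    unfolding v by algebra
  then show ?thesis
    using assms(4) by metis
qed

lemma Wh_exchange_y:
  assumes "v \<in> Wh Nx Ny" "i \<in> {1..Nx}" "j \<in> {1..Ny}" "y1 + y2 = y3 + y4"
  shows "v i j (x, y1) + v i j (x, y2) = v i j (x, y3) + v i j (x, y4)"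
proof -
  obtain a b c d where v: "\<And>x y. v i j (x, y) = a + b * x + c * y + d * x * y"
    using Wh_bilinear[OF assms(1-3)] by blast
  have "v i j (x, y) + v i j (x, y') = 2 * (a + b * x) + (c + d * x) * (y + y')" for y y'
    unfolding v by algebra
  then show ?thesis
    using assms(4) by metis
qed

lemma Wh_grad:
  assumes "v \<in> Wh Nx Ny" "i \<in> {1..Nx}" "j \<in> {1..Ny}"
  shows "grad v i j (x, y) $ 1 = (v i j (node Nx i, y) - v i j (node Nx (i - 1), y)) / step Nx"
    and "grad v i j (x, y) $ 2 = (v i j (x, node Ny j) - v i j (x, node Ny (j - 1))) / step Ny"
proof -
  obtain a b c d where v: "\<And>x y. v i j (x, y) = a + b * x + c * y + d * x * y"
    using Wh_bilinear[OF assms] by blast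
  have pos: "step Nx > 0" "step Ny > 0"
    using assms step_pos by auto
  have "((\<lambda>x. v i j (x, y)) has_field_derivative b + d * y) (at x)"
    unfolding v by (auto intro!: derivative_eq_intros)
  moreover have "((\<lambda>y. v i j (x, y)) has_field_derivative c + d * x) (at y)"
    unfolding v by (auto intro!: derivative_eq_intros)
  ultimately have "grad v i j (x, y) $ 1 = b + d * y" "grad v i j (x, y) $ 2 = c + d * x"
    by (simp_all add: grad_def DERIV_imp_deriv)
  moreover have "v i j (node Nx i, y) - v i j (node Nx (i - 1), y) = (b + d * y) * step Nx"
    and "v i j (x, node Ny j) - v i j (x, node Ny (j - 1)) = (c + d * x) * step Ny"
    using assms by (simp_all add: v node_pred algebra_simps)
  ultimately show "grad v i j (x, y) $ 1 = (v i j (node Nx i, y) - v i j (node Nx (i - 1), y)) / step Nx"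
    and "grad v i j (x, y) $ 2 = (v i j (x, node Ny j) - v i j (x, node Ny (j - 1))) / step Ny"
    using pos by simp_all
qed

lemma integral_affine_interval:
  fixes a b p q :: real
  assumes "a \<le> b"
  shows "integral {a..b} (\<lambda>x. p + q * x) = (b - a) * (p + q * ((a + b) / 2))"
proof (rule integral_unique)
  have "((\<lambda>x. p + q * x) has_integral (p * b + q * b\<^sup>2 / 2) - (p * a + q * a\<^sup>2 / 2)) {a..b}"
    by (rule fundamental_theorem_of_calculus[OF assms])
       (auto simp: has_real_derivative_iff_has_vector_derivative[symmetric]
             intro!: derivative_eq_intros)
  also have "(p * b + q * b\<^sup>2 / 2) - (p * a + q * a\<^sup>2 / 2) = (b - a) * (p + q * ((a + b) / 2))"
    by (simp add: power2_eq_square field_simps)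
  finally show "((\<lambda>x. p + q * x) has_integral (b - a) * (p + q * ((a + b) / 2))) {a..b}" .
qed

lemma Wh_integral_cell:
  assumes "v \<in> Wh Nx Ny" "i \<in> {1..Nx}" "j \<in> {1..Ny}"
  shows "integral (cell Nx Ny i j) (v i j) = step Nx * step Ny *
    v i j ((node Nx (i - 1) + node Nx i) / 2, (node Ny (j - 1) + node Ny j) / 2)"
proof -
  obtain a b c d where v: "\<And>x y. v i j (x, y) = a + b * x + c * y + d * x * y"
    using Wh_bilinear[OF assms] by blast
  have pos: "step Nx > 0" "step Ny > 0"
    using assms step_pos by auto
  let ?xl = "node Nx (i - 1)" and ?xr = "node Nx i" and ?yl = "node Ny (j - 1)" and ?yr = "node Ny j"
  have w: "?xr - ?xl = step Nx" "?yr - ?yl = step Ny"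
    using assms by (simp_all add: node_pred)
  have le: "?xl \<le> ?xr" "?yl \<le> ?yr"
    using w pos by linarith+
  define ym where "ym = (?yl + ?yr) / 2"
  have v': "v i j = (\<lambda>z. a + b * fst z + c * snd z + d * fst z * snd z)"
    using v by (auto simp: fun_eq_iff)
  have "integral (cell Nx Ny i j) (v i j)
      = integral (cbox ?xl ?xr) (\<lambda>x. integral (cbox ?yl ?yr) (\<lambda>y. v i j (x, y)))"
    unfolding cell_def cbox_Pair_eq[of ?xl ?yl ?xr ?yr, simplified, symmetric]
    by (subst integral_prod_continuous) (auto simp: v' intro!: continuous_intros)
  also have "\<dots> = integral {?xl..?xr} (\<lambda>x. step Ny * (a + c * ym) + step Ny * (b + d * ym) * x)"
  proof -
    have "integral {?yl..?yr} (\<lambda>y. v i j (x, y)) = step Ny * (a + c * ym) + step Ny * (b + d * ym) * x" for x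
    proof -
      have "(\<lambda>y. v i j (x, y)) = (\<lambda>y. (a + b * x) + (c + d * x) * y)"
        by (auto simp: v algebra_simps)
      then have "integral {?yl..?yr} (\<lambda>y. v i j (x, y)) = step Ny * ((a + b * x) + (c + d * x) * ym)"
        by (simp only: integral_affine_interval[OF le(2)] w(2) ym_def[symmetric])
      then show ?thesis by algebra
    qed
    then show ?thesis by simp
  qed
  also have "\<dots> = step Nx * step Ny * v i j ((?xl + ?xr) / 2, (?yl + ?yr) / 2)"
    unfolding integral_affine_interval[OF le(1)] w(1) v ym_def[symmetric] by algebra
  finally show ?thesis .
qed

text \<open>
  The four-point formulas that allow losses at edges and at interior Gauss points to be charged to the
  mean value.
\<close>

lemma Wh_cell_avg:
  assumes "v \<in> Wh Nx Ny" "i \<in> {1..Nx}" "j \<in> {1..Ny}"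
  shows "4 * cell_avg Nx Ny v i j = (\<Sum>b\<in>{1, 2}. v i j (node Nx (i - 1), gauss Ny j b)
            + v i j (node Nx i, gauss Ny j b))" (is ?V)
    and "4 * cell_avg Nx Ny v i j = (\<Sum>b\<in>{1, 2}. v i j (gauss Nx i b, node Ny (j - 1))
            + v i j (gauss Nx i b, node Ny j))" (is ?H)
    and "4 * cell_avg Nx Ny v i j = (\<Sum>b\<in>{1, 2}. \<Sum>g\<in>{1, 2}. v i j (gauss Nx i b, gauss Ny j g))" (is ?G)
proof -
  have pos: "step Nx > 0" "step Ny > 0"
    using assms step_pos by auto
  define xm ym where "xm = (node Nx (i - 1) + node Nx i) / 2" and "ym = (node Ny (j - 1) + node Ny j) / 2"
  have avg: "cell_avg Nx Ny v i j = v i j (xm, ym)"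
    using pos by (simp add: cell_avg_def Wh_integral_cell[OF assms] xm_def ym_def)
  have nx: "node Nx (i - 1) + node Nx i = xm + xm" "node Ny (j - 1) + node Ny j = ym + ym"
    by (simp_all add: xm_def ym_def)
  then have gx: "gauss Nx i 1 + gauss Nx i 2 = xm + xm" "gauss Ny j 1 + gauss Ny j 2 = ym + ym"
    using assms by (simp_all only: gauss_symmetric atLeastAtMost_iff)
  note ex = Wh_exchange_x[OF assms nx(1)] Wh_exchange_x[OF assms gx(1)]
            Wh_exchange_y[OF assms nx(2)] Wh_exchange_y[OF assms gx(2)]
  show ?V
    unfolding sum_gauss_points avg
    using ex(1)[of "gauss Ny j 1"] ex(1)[of "gauss Ny j 2"] ex(4)[of xm] by linarith
  show ?H
    unfolding sum_gauss_points avg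
    using ex(3)[of "gauss Nx i 1"] ex(3)[of "gauss Nx i 2"] ex(2)[of ym] by linarith
  show ?G
    unfolding sum_gauss_points avg
    using ex(4)[of "gauss Nx i 1"] ex(4)[of "gauss Nx i 2"] ex(2)[of ym] by linarith
qed

text \<open>
  Converts end point values of an edge, which occur in tangential derivatives, into the values at the
  Gauss points, which occur in the quadrature.
\<close>

lemma Wh_edge_gauss_sum:
  assumes "v \<in> Wh Nx Ny" "i \<in> {1..Nx}" "j \<in> {1..Ny}"
  shows "v i j (x, node Ny (j - 1)) + v i j (x, node Ny j) = (\<Sum>b\<in>{1, 2}. v i j (x, gauss Ny j b))"
    and "v i j (node Nx (i - 1), y) + v i j (node Nx i, y) = (\<Sum>b\<in>{1, 2}. v i j (gauss Nx i b, y))"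
  unfolding sum_gauss_points using assms
  by (auto intro!: Wh_exchange_x[OF assms] Wh_exchange_y[OF assms] gauss_symmetric[symmetric]
        simp del: One_nat_def)

section \<open>The concentration compared with r\<close>

lemma interp_in_Wh: "interp Nx Ny g \<in> Wh Nx Ny"
proof -
  have "\<exists>a b c d. \<forall>x y. interp Nx Ny g i j (x, y) = a + b * x + c * y + d * x * y" for i j
  proof -
    define xl yl p q where "xl = node Nx (i - 1)" and "yl = node Ny (j - 1)"
      and "p = 1 / (node Nx i - xl)" and "q = 1 / (node Ny j - yl)"
    define g1 g2 g3 g4 where "g1 = g i j (xl, yl)" and "g2 = g i j (node Nx i, yl)"
      and "g3 = g i j (xl, node Ny j)" and "g4 = g i j (node Nx i, node Ny j)"
    have g: "interp Nx Ny g i j (x, y) = (1 - p * (x - xl)) * (1 - q * (y - yl)) * g1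
        + p * (x - xl) * (1 - q * (y - yl)) * g2 + (1 - p * (x - xl)) * (q * (y - yl)) * g3
        + p * (x - xl) * (q * (y - yl)) * g4" for x y
      by (simp add: interp_def Let_def xl_def yl_def p_def q_def g1_def g2_def g3_def g4_def)
    define h where "h = g1 - g2 - g3 + g4"
    have "interp Nx Ny g i j (x, y) =
        (g1 + p * xl * (g1 - g2) + q * yl * (g1 - g3) + p * q * xl * yl * h)
        + (p * (g2 - g1) - p * q * yl * h) * x + (q * (g3 - g1) - p * q * xl * h) * y
        + (p * q * h) * x * y" for x y
      unfolding g h_def by (simp add: algebra_simps)
    then show ?thesis by blast
  qed
  then show ?thesis by (simp add: Wh_def)
qed

lemma interp_node:
  assumes "i \<in> {1..Nx}" "j \<in> {1..Ny}" "k \<in> {i - 1, i}" "l \<in> {j - 1, j}"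
  shows "interp Nx Ny g i j (node Nx k, node Ny l) = g i j (node Nx k, node Ny l)"
proof -
  have "node Nx i - node Nx (i - 1) \<noteq> 0" "node Ny j - node Ny (j - 1) \<noteq> 0"
    using assms step_pos[of Nx] step_pos[of Ny] by (simp_all add: node_pred)
  then show ?thesis
    using assms(3,4) by (auto simp: interp_def Let_def)
qed

lemma affine_nonneg:
  fixes a b s x y :: real
  assumes "x \<le> s" "s \<le> y" "a + b * x \<ge> 0" "a + b * y \<ge> 0"
  shows "a + b * s \<ge> 0"
proof (cases "b \<ge> 0")
  case True
  then have "b * x \<le> b * s" using assms(1) by (simp add: mult_left_mono)
  then show ?thesis using assms(3) by linarith
next
  case False
  then have "b * y \<le> b * s" using assms(2) by (simp add: mult_left_mono_neg)
  then show ?thesis using assms(4) by linarith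
qed

lemma Wh_nonneg_on_edge:
  assumes v: "v \<in> Wh Nx Ny" and ij: "i \<in> {1..Nx}" "j \<in> {1..Ny}"
  shows "\<lbrakk>v i j (x, node Ny (j - 1)) \<ge> 0; v i j (x, node Ny j) \<ge> 0;
          node Ny (j - 1) \<le> y; y \<le> node Ny j\<rbrakk> \<Longrightarrow> v i j (x, y) \<ge> 0"
    and "\<lbrakk>v i j (node Nx (i - 1), y) \<ge> 0; v i j (node Nx i, y) \<ge> 0;
          node Nx (i - 1) \<le> x; x \<le> node Nx i\<rbrakk> \<Longrightarrow> v i j (x, y) \<ge> 0"
proof -
  obtain a b c d where v: "\<And>x y. v i j (x, y) = a + b * x + c * y + d * x * y"
    using Wh_bilinear[OF v ij] by blast
  have v1: "v i j (x, y) = (a + b * x) + (c + d * x) * y"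
    and v2: "v i j (x, y) = (a + c * y) + (b + d * y) * x" for x y
    by (simp_all add: v algebra_simps)
  show "\<lbrakk>v i j (x, node Ny (j - 1)) \<ge> 0; v i j (x, node Ny j) \<ge> 0;
          node Ny (j - 1) \<le> y; y \<le> node Ny j\<rbrakk> \<Longrightarrow> v i j (x, y) \<ge> 0"
    unfolding v1 by (rule affine_nonneg)
  show "\<lbrakk>v i j (node Nx (i - 1), y) \<ge> 0; v i j (node Nx i, y) \<ge> 0;
          node Nx (i - 1) \<le> x; x \<le> node Nx i\<rbrakk> \<Longrightarrow> v i j (x, y) \<ge> 0"
    unfolding v2 by (rule affine_nonneg)
qed

lemma Wh_diff_scaled:
  assumes "v \<in> Wh Nx Ny" "w \<in> Wh Nx Ny"
  shows "(\<lambda>i j z. v i j z - m * w i j z) \<in> Wh Nx Ny"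
  unfolding Wh_def mem_Collect_eq
proof (intro ballI)
  fix i j assume ij: "i \<in> {1..Nx}" "j \<in> {1..Ny}"
  obtain a b c d where v: "\<And>x y. v i j (x, y) = a + b * x + c * y + d * x * y"
    using Wh_bilinear[OF assms(1) ij] by blast
  obtain a' b' c' d' where w: "\<And>x y. w i j (x, y) = a' + b' * x + c' * y + d' * x * y"
    using Wh_bilinear[OF assms(2) ij] by blast
  have "v i j (x, y) - m * w i j (x, y)
      = (a - m * a') + (b - m * b') * x + (c - m * c') * y + (d - m * d') * x * y" for x y
    by (simp add: v w algebra_simps)
  then show "\<exists>a b c d. \<forall>x y. v i j (x, y) - m * w i j (x, y) = a + b * x + c * y + d * x * y"
    by blast
qed

lemma conc_in_Wh: "conc Nx Ny \<phi> r \<in> Wh Nx Ny"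
  unfolding conc_def by (rule interp_in_Wh)

lemma conc_node:
  assumes "i \<in> {1..Nx}" "j \<in> {1..Ny}" "k \<in> {i - 1, i}" "l \<in> {j - 1, j}"
  shows "conc Nx Ny \<phi> r i j (node Nx k, node Ny l)
    = r i j (node Nx k, node Ny l) / Phi_node Nx Ny \<phi> k l"
  unfolding conc_def Phi_h_def Phi_node_def interp_node[OF assms] ..

lemma Phi_node_pos:
  assumes "Nx \<ge> 1" "Ny \<ge> 1" "\<forall>z\<in>Omega. \<phi> z > 0" "k \<le> Nx" "l \<le> Ny"
  shows "Phi_node Nx Ny \<phi> k l > 0"
  using assms node_bounds[of Nx k] node_bounds[of Ny l]
  by (auto simp: Phi_node_def Omega_def)

lemma node_in_cell:
  assumes "i \<in> {1..Nx}" "j \<in> {1..Ny}" "k \<in> {i - 1, i}" "l \<in> {j - 1, j}"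
  shows "(node Nx k, node Ny l) \<in> cell Nx Ny i j"
  using node_in_interval[of Nx i k] node_in_interval[of Ny j l] assms by (auto simp: cell_def)

text \<open>
  The difference \<open>r - m * c\<close> is again bilinear, so its sign on an edge or on the cell can be read off at
  the corners, where \<open>c\<close> is exactly \<open>r / \<Phi>\<close>. On an edge only its two end points matter; this is why
  the convective time step restriction can be stated with the two values of \<open>\<Phi>\<close> on that edge.
\<close>

lemma scaled_conc_le_at_node:
  assumes phi: "\<forall>z\<in>Omega. \<phi> z > 0" and rpos: "\<forall>z\<in>cell Nx Ny i j. r i j z > 0"
    and ij: "i \<in> {1..Nx}" "j \<in> {1..Ny}" and kl: "k \<in> {i - 1, i}" "l \<in> {j - 1, j}"
    and m: "m \<le> Phi_node Nx Ny \<phi> k l"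
  shows "0 \<le> r i j (node Nx k, node Ny l) - m * conc Nx Ny \<phi> r i j (node Nx k, node Ny l)"
proof -
  have P: "Phi_node Nx Ny \<phi> k l > 0"
    using ij kl by (intro Phi_node_pos phi) auto
  have R: "r i j (node Nx k, node Ny l) > 0"
    using rpos node_in_cell[OF ij kl] by blast
  have "m * r i j (node Nx k, node Ny l) \<le> Phi_node Nx Ny \<phi> k l * r i j (node Nx k, node Ny l)"
    using m R by simp
  then show ?thesis
    using P by (simp add: conc_node[OF ij kl] field_simps)
qed

lemma scaled_conc_le_vert:
  assumes phi: "\<forall>z\<in>Omega. \<phi> z > 0" and r: "r \<in> Wh Nx Ny"
    and rpos: "\<forall>z\<in>cell Nx Ny i j. r i j z > 0"
    and ij: "i \<in> {1..Nx}" "j \<in> {1..Ny}" and k: "k \<in> {i - 1, i}"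
    and m: "\<forall>l\<in>{j - 1, j}. m \<le> Phi_node Nx Ny \<phi> k l"
    and y: "node Ny (j - 1) \<le> y" "y \<le> node Ny j"
  shows "m * conc Nx Ny \<phi> r i j (node Nx k, y) \<le> r i j (node Nx k, y)"
proof -
  have "0 \<le> r i j (node Nx k, y) - m * conc Nx Ny \<phi> r i j (node Nx k, y)"
    by (rule Wh_nonneg_on_edge(1)[OF Wh_diff_scaled[OF r conc_in_Wh] ij _ _ y])
       (use m in \<open>auto simp del: diff_ge_0_iff_ge
          intro!: scaled_conc_le_at_node[where i = i and j = j and r = r, OF phi rpos ij k]\<close>)
  then show ?thesis by simp
qed

lemma scaled_conc_le_horiz:
  assumes phi: "\<forall>z\<in>Omega. \<phi> z > 0" and r: "r \<in> Wh Nx Ny"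
    and rpos: "\<forall>z\<in>cell Nx Ny i j. r i j z > 0"
    and ij: "i \<in> {1..Nx}" "j \<in> {1..Ny}" and l: "l \<in> {j - 1, j}"
    and m: "\<forall>k\<in>{i - 1, i}. m \<le> Phi_node Nx Ny \<phi> k l"
    and x: "node Nx (i - 1) \<le> x" "x \<le> node Nx i"
  shows "m * conc Nx Ny \<phi> r i j (x, node Ny l) \<le> r i j (x, node Ny l)"
proof -
  have "0 \<le> r i j (x, node Ny l) - m * conc Nx Ny \<phi> r i j (x, node Ny l)"
    by (rule Wh_nonneg_on_edge(2)[OF Wh_diff_scaled[OF r conc_in_Wh] ij _ _ x])
       (use m in \<open>auto simp del: diff_ge_0_iff_ge
          intro!: scaled_conc_le_at_node[where i = i and j = j and r = r, OF phi rpos ij _ l]\<close>)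
  then show ?thesis by simp
qed

lemma scaled_conc_le_cell:
  assumes phi: "\<forall>z\<in>Omega. \<phi> z > 0" and r: "r \<in> Wh Nx Ny"
    and rpos: "\<forall>z\<in>cell Nx Ny i j. r i j z > 0"
    and ij: "i \<in> {1..Nx}" "j \<in> {1..Ny}"
    and m: "m \<le> Phi_cell_min Nx Ny \<phi> i j"
    and z: "z \<in> cell Nx Ny i j"
  shows "m * conc Nx Ny \<phi> r i j z \<le> r i j z"
proof -
  have fin: "finite {Phi_node Nx Ny \<phi> k l | k l. k \<in> {i - 1, i} \<and> l \<in> {j - 1, j}}"
    by (rule finite_image_set2) auto
  have m': "m \<le> Phi_node Nx Ny \<phi> k l" if "k \<in> {i - 1, i}" "l \<in> {j - 1, j}" for k l
    using m Min_le[OF fin, of "Phi_node Nx Ny \<phi> k l"] that unfolding Phi_cell_min_def by fastforce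
  obtain x y where zxy: "z = (x, y)" by (cases z)
  with z have x: "node Nx (i - 1) \<le> x" "x \<le> node Nx i" and y: "node Ny (j - 1) \<le> y" "y \<le> node Ny j"
    by (auto simp: cell_def)
  have "0 \<le> r i j (x, y) - m * conc Nx Ny \<phi> r i j (x, y)"
    by (rule Wh_nonneg_on_edge(2)[OF Wh_diff_scaled[OF r conc_in_Wh] ij _ _ x])
       (use m' in \<open>auto simp: le_diff_eq intro!: scaled_conc_le_vert[where i = i and j = j and r = r, OF phi r rpos ij _ _ y]\<close>)
  then show ?thesis by (simp add: zxy)
qed

lemma conc_nonneg:
  assumes phi: "\<forall>z\<in>Omega. \<phi> z > 0" and rpos: "\<forall>z\<in>cell Nx Ny i j. r i j z > 0"
    and ij: "i \<in> {1..Nx}" "j \<in> {1..Ny}" and z: "z \<in> cell Nx Ny i j"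
  shows "0 \<le> conc Nx Ny \<phi> r i j z"
proof -
  obtain x y where zxy: "z = (x, y)" by (cases z)
  with z have x: "node Nx (i - 1) \<le> x" "x \<le> node Nx i" and y: "node Ny (j - 1) \<le> y" "y \<le> node Ny j"
    by (auto simp: cell_def)
  have n: "0 \<le> conc Nx Ny \<phi> r i j (node Nx k, node Ny l)" if "k \<in> {i - 1, i}" "l \<in> {j - 1, j}" for k l
  proof -
    have "Phi_node Nx Ny \<phi> k l > 0"
      using ij that by (intro Phi_node_pos phi) auto
    moreover have "r i j (node Nx k, node Ny l) > 0"
      using rpos node_in_cell[OF ij that] by blast
    ultimately show ?thesis
      unfolding conc_node[OF ij that] by simp
  qed
  show ?thesis
    unfolding zxy using n
    by (intro Wh_nonneg_on_edge(2)[OF conc_in_Wh ij _ _ x] Wh_nonneg_on_edge(1)[OF conc_in_Wh ij _ _ y]) auto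
qed

section \<open>The balance of cell averages\<close>

text \<open>
  The flux in the direction of the normal: convection, diffusion and penalty. The symmetrising term
  with \<open>D(u) \<nabla>\<zeta>\<close> has no counterpart, because it vanishes for test functions that are constant on cells.
\<close>

definition num_flux ::
  "nat \<Rightarrow> nat \<Rightarrow> (real \<times> real \<Rightarrow> real ^ 2 \<Rightarrow> real ^ 2 ^ 2) \<Rightarrow> real \<Rightarrow> real \<Rightarrow>
   (real ^ 2) cellfun \<Rightarrow> real cellfun \<Rightarrow> edge \<Rightarrow> real \<times> real \<Rightarrow> real" where
  "num_flux Nx Ny D \<alpha> \<alpha>' u c e z = uc_hat Nx Ny \<alpha> u c e z \<bullet> normal e
     - avg Nx Ny (\<lambda>i j z. diff_flux D u c i j z \<bullet> normal e) e z
     - \<alpha>' / len Nx Ny e * jump Nx Ny c e z"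

definition cell_ind :: "nat \<Rightarrow> nat \<Rightarrow> real cellfun" where
  "cell_ind i j i' j' z = (if i' = i \<and> j' = j then 1 else 0)"

lemma cell_ind_in_Wh: "cell_ind i j \<in> Wh Nx Ny"
proof -
  have "\<forall>x y. cell_ind i j i' j' (x, y) = (if i' = i \<and> j' = j then 1 else 0) + 0 * x + 0 * y + 0 * x * y" for i' j'
    by (simp add: cell_ind_def)
  then show ?thesis
    unfolding Wh_def by blast
qed

lemma grad_cell_ind: "grad (cell_ind i j) = (\<lambda>i j z. 0)"
  by (auto simp: fun_eq_iff grad_def cell_ind_def vec_eq_iff forall_2)

lemma sum_cell_ind:
  fixes F :: "nat \<Rightarrow> nat \<Rightarrow> real"
  assumes "i \<in> {1..Nx}" "j \<in> {1..Ny}"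
  shows "(\<Sum>i'=1..Nx. \<Sum>j'=1..Ny. (if i' = i \<and> j' = j then F i' j' else 0)) = F i j"
proof -
  have "(\<Sum>j'=1..Ny. (if i' = i \<and> j' = j then F i' j' else 0)) = (if i' = i then F i j else 0)" for i'
    using assms by (cases "i' = i") (simp_all add: sum.delta)
  then show ?thesis
    using assms by (simp add: sum.delta)
qed

lemma ip_cell_ind:
  assumes "i \<in> {1..Nx}" "j \<in> {1..Ny}"
  shows "ip Nx Ny v (cell_ind i j) = integral (cell Nx Ny i j) (v i j)"
proof -
  have "integral (cell Nx Ny i' j') (\<lambda>z. v i' j' z \<bullet> cell_ind i j i' j' z)
      = (if i' = i \<and> j' = j then integral (cell Nx Ny i' j') (v i' j') else 0)" for i' j'
    by (auto simp: cell_ind_def)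
  then show ?thesis
    unfolding ip_def by (simp add: sum_cell_ind[OF assms])
qed

lemma ip_gauss_cell_ind:
  assumes "i \<in> {1..Nx}" "j \<in> {1..Ny}"
  shows "ip_gauss Nx Ny v (cell_ind i j) = step Nx * step Ny / 4 *
     (\<Sum>b\<in>{1, 2}. \<Sum>g\<in>{1, 2}. v i j (gauss Nx i b, gauss Ny j g))"
proof -
  let ?F = "\<lambda>i j. step Nx * step Ny / 4 * (\<Sum>b\<in>{1, 2}. \<Sum>g\<in>{1, 2}. v i j (gauss Nx i b, gauss Ny j g))"
  have "step Nx * step Ny / 4 * (\<Sum>b\<in>{1, 2}. \<Sum>g\<in>{1, 2}. v i' j' (gauss Nx i' b, gauss Ny j' g)
        * cell_ind i j i' j' (gauss Nx i' b, gauss Ny j' g))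
      = (if i' = i \<and> j' = j then ?F i' j' else 0)" for i' j'
    by (auto simp: cell_ind_def)
  then show ?thesis
    unfolding ip_gauss_def by (simp only: sum_cell_ind[OF assms])
qed

lemma finite_edges: "finite (edges Nx Ny)"
  unfolding edges_def by (intro finite_UnI finite_image_set2) auto

text \<open>
  The indicator jumps by \<open>1\<close> across the left and the lower edge and by \<open>- 1\<close> across the right and the upper
  edge of its cell, and nowhere else. All four are interior edges only if the cell is away from the
  boundary.
\<close>

lemma sum_edges0_cell_ind:
  assumes i: "1 < i" "i < Nx" and j: "1 < j" "j < Ny"
  shows "(\<Sum>e\<in>edges0 Nx Ny. edge_quad Nx Ny e (\<lambda>z. G e z * jump Nx Ny (cell_ind i j) e z))
    = edge_quad Nx Ny (Vert (i - 1) j) (G (Vert (i - 1) j)) - edge_quad Nx Ny (Vert i j) (G (Vert i j))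
      + edge_quad Nx Ny (Horiz i (j - 1)) (G (Horiz i (j - 1))) - edge_quad Nx Ny (Horiz i j) (G (Horiz i j))"
proof -
  let ?S = "{Vert (i - 1) j, Vert i j, Horiz i (j - 1), Horiz i j}"
  let ?q = "\<lambda>e. edge_quad Nx Ny e (\<lambda>z. G e z * jump Nx Ny (cell_ind i j) e z)"
  have "(\<Sum>e\<in>edges0 Nx Ny. ?q e) = (\<Sum>e\<in>?S. ?q e)"
  proof (rule sum.mono_neutral_right)
    show "finite (edges0 Nx Ny)"
      using finite_edges by (simp add: edges0_def)
    show "?S \<subseteq> edges0 Nx Ny"
      using i j by (auto simp: edges0_def edges_def bdry_plus_def bdry_minus_def)
    show "\<forall>e\<in>edges0 Nx Ny - ?S. ?q e = 0"
    proof
      fix e assume e: "e \<in> edges0 Nx Ny - ?S"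
      have "jump Nx Ny (cell_ind i j) e z = 0" for z
      proof (cases e)
        case (Vert k l)
        then have "\<not> (k = i \<and> l = j)" "\<not> (k + 1 = i \<and> l = j)"
          using e by auto
        then show ?thesis
          by (auto simp: Vert jump_def cell_ind_def)
      next
        case (Horiz k l)
        then have "\<not> (k = i \<and> l = j)" "\<not> (k = i \<and> l + 1 = j)"
          using e by auto
        then show ?thesis
          by (auto simp: Horiz jump_def cell_ind_def)
      qed
      then show "?q e = 0"
        by (simp add: edge_quad_def)
    qed
  qed
  moreover have "jump Nx Ny (cell_ind i j) (Vert (i - 1) j) z = 1" "jump Nx Ny (cell_ind i j) (Vert i j) z = - 1"
    "jump Nx Ny (cell_ind i j) (Horiz i (j - 1)) z = 1" "jump Nx Ny (cell_ind i j) (Horiz i j) z = - 1" for z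
    using i j by (auto simp: jump_def cell_ind_def)
  moreover have "i - 1 \<noteq> i" "j - 1 \<noteq> j"
    using i j by auto
  ultimately show ?thesis
    by (simp add: edge_quad_def algebra_simps)
qed

lemma cell_balance:
  assumes eq: "conc_eq Nx Ny z1 q ct D \<alpha> \<alpha>' r c u pt (\<lambda>i j z. (r' i j z - r i j z) / dt)"
    and r: "r \<in> Wh Nx Ny" "r' \<in> Wh Nx Ny" and i: "1 < i" "i < Nx" and j: "1 < j" "j < Ny"
  shows "step Nx * step Ny * (cell_avg Nx Ny r' i j - cell_avg Nx Ny r i j) / dt
    = step Nx * step Ny / 4 * (\<Sum>b\<in>{1, 2}. \<Sum>g\<in>{1, 2}.
        ct (gauss Nx i b, gauss Ny j g) * q (gauss Nx i b, gauss Ny j g)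
        - r i j (gauss Nx i b, gauss Ny j g) * z1 * pt i j (gauss Nx i b, gauss Ny j g))
      + edge_quad Nx Ny (Vert (i - 1) j) (num_flux Nx Ny D \<alpha> \<alpha>' u c (Vert (i - 1) j))
      - edge_quad Nx Ny (Vert i j) (num_flux Nx Ny D \<alpha> \<alpha>' u c (Vert i j))
      + edge_quad Nx Ny (Horiz i (j - 1)) (num_flux Nx Ny D \<alpha> \<alpha>' u c (Horiz i (j - 1)))
      - edge_quad Nx Ny (Horiz i j) (num_flux Nx Ny D \<alpha> \<alpha>' u c (Horiz i j))"
proof -
  have ij: "i \<in> {1..Nx}" "j \<in> {1..Ny}"
    using i j by auto
  have pos: "step Nx > 0" "step Ny > 0"
    using ij step_pos by auto
  let ?F = "num_flux Nx Ny D \<alpha> \<alpha>' u c" and ?\<zeta> = "cell_ind i j"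
  let ?rt = "\<lambda>z. (r' i j z - r i j z) / dt"
  have rt: "integral (cell Nx Ny i j) ?rt
      = step Nx * step Ny * (cell_avg Nx Ny r' i j - cell_avg Nx Ny r i j) / dt"
  proof -
    let ?d = "\<lambda>i j z. r' i j z - 1 * r i j z"
    have "integral (cell Nx Ny i j) ?rt = integral (cell Nx Ny i j) (?d i j) / dt"
      by simp
    also have "integral (cell Nx Ny i j) (?d i j)
        = integral (cell Nx Ny i j) (r' i j) - integral (cell Nx Ny i j) (r i j)"
      unfolding Wh_integral_cell[OF Wh_diff_scaled[OF r(2,1)] ij]
        Wh_integral_cell[OF r(1) ij] Wh_integral_cell[OF r(2) ij] by (simp add: right_diff_distrib)
    also have "\<dots> = step Nx * step Ny * (cell_avg Nx Ny r' i j - cell_avg Nx Ny r i j)"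
      using pos by (simp add: cell_avg_def right_diff_distrib)
    finally show ?thesis .
  qed
  have zero: "diff_flux D u ?\<zeta> i' j' z = 0" for i' j' z
    by (simp add: diff_flux_def grad_cell_ind)
  have avg0: "avg Nx Ny (\<lambda>i j z. diff_flux D u ?\<zeta> i j z \<bullet> normal e) e z = 0" for e z
    by (cases e) (auto simp: avg_def zero)
  have "ip Nx Ny (\<lambda>i j z. (r' i j z - r i j z) / dt) ?\<zeta>
      = ip_gauss Nx Ny (\<lambda>i j z. ct z * q z - r i j z * z1 * pt i j z) ?\<zeta>
        + (\<Sum>e\<in>edges0 Nx Ny. edge_quad Nx Ny e (\<lambda>z. (uc_hat Nx Ny \<alpha> u c e z \<bullet> normal e) * jump Nx Ny ?\<zeta> e z))
        - (\<Sum>e\<in>edges0 Nx Ny. edge_quad Nx Ny e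
            (\<lambda>z. avg Nx Ny (\<lambda>i j z. diff_flux D u c i j z \<bullet> normal e) e z * jump Nx Ny ?\<zeta> e z
               + \<alpha>' / len Nx Ny e * jump Nx Ny c e z * jump Nx Ny ?\<zeta> e z))"
    using eq[unfolded conc_eq_def, rule_format, OF cell_ind_in_Wh[of i j]]
    by (simp add: avg0 grad_cell_ind) (simp add: ip_def)
  also have "\<dots> = ip_gauss Nx Ny (\<lambda>i j z. ct z * q z - r i j z * z1 * pt i j z) ?\<zeta>
        + (\<Sum>e\<in>edges0 Nx Ny. edge_quad Nx Ny e (\<lambda>z. ?F e z * jump Nx Ny ?\<zeta> e z))"
    unfolding add_diff_eq[symmetric] sum_subtractf[symmetric]
    by (simp add: edge_quad_def num_flux_def algebra_simps)
  finally show ?thesis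
    unfolding ip_cell_ind[OF ij] rt ip_gauss_cell_ind[OF ij] sum_edges0_cell_ind[OF i j]
    by (simp add: algebra_simps)
qed

section \<open>Bounding the outflow through one edge\<close>

lemma diff_flux_component:
  assumes "c \<in> Wh Nx Ny" "i \<in> {1..Nx}" "j \<in> {1..Ny}"
  shows "diff_flux D u c i j (x, y) $ k =
      D (x, y) (u i j (x, y)) $ k $ 1 * (c i j (node Nx i, y) - c i j (node Nx (i - 1), y)) / step Nx
    + D (x, y) (u i j (x, y)) $ k $ 2 * (c i j (x, node Ny j) - c i j (x, node Ny (j - 1))) / step Ny"
  by (simp add: diff_flux_def matrix_vector_mult_def sum_2 Wh_grad[OF assms])

lemma num_flux_Vert:
  assumes c: "c \<in> Wh Nx Ny" and i: "i \<in> {1..<Nx}" and j: "j \<in> {1..Ny}"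
  shows "num_flux Nx Ny D \<alpha> \<alpha>' u c (Vert i j) (node Nx i, y) =
      u (i + 1) j (node Nx i, y) $ 1 * c (i + 1) j (node Nx i, y)
      - \<alpha> * (c (i + 1) j (node Nx i, y) - c i j (node Nx i, y))
      - (D (node Nx i, y) (u (i + 1) j (node Nx i, y)) $ 1 $ 1
            * (c (i + 1) j (node Nx (i + 1), y) - c (i + 1) j (node Nx i, y)) / step Nx
         + D (node Nx i, y) (u (i + 1) j (node Nx i, y)) $ 1 $ 2
            * (c (i + 1) j (node Nx i, node Ny j) - c (i + 1) j (node Nx i, node Ny (j - 1))) / step Ny) / 2
      - (D (node Nx i, y) (u i j (node Nx i, y)) $ 1 $ 1
            * (c i j (node Nx i, y) - c i j (node Nx (i - 1), y)) / step Nx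
         + D (node Nx i, y) (u i j (node Nx i, y)) $ 1 $ 2
            * (c i j (node Nx i, node Ny j) - c i j (node Nx i, node Ny (j - 1))) / step Ny) / 2
      - \<alpha>' / step Ny * (c (i + 1) j (node Nx i, y) - c i j (node Nx i, y))"
proof -
  have i': "i \<in> {1..Nx}" "i + 1 \<in> {1..Nx}" "i \<noteq> 0" "i \<noteq> Nx"
    using i by auto
  show ?thesis
    using i'(3,4)
    by (simp add: num_flux_def uc_hat_def avg_def jump_def inner_axis add_divide_distrib
        diff_flux_component[OF c i'(1) j] diff_flux_component[OF c i'(2) j])
qed

lemma num_flux_Horiz:
  assumes c: "c \<in> Wh Nx Ny" and i: "i \<in> {1..Nx}" and j: "j \<in> {1..<Ny}"
  shows "num_flux Nx Ny D \<alpha> \<alpha>' u c (Horiz i j) (x, node Ny j) =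
      u i (j + 1) (x, node Ny j) $ 2 * c i (j + 1) (x, node Ny j)
      - \<alpha> * (c i (j + 1) (x, node Ny j) - c i j (x, node Ny j))
      - (D (x, node Ny j) (u i (j + 1) (x, node Ny j)) $ 2 $ 2
            * (c i (j + 1) (x, node Ny (j + 1)) - c i (j + 1) (x, node Ny j)) / step Ny
         + D (x, node Ny j) (u i (j + 1) (x, node Ny j)) $ 2 $ 1
            * (c i (j + 1) (node Nx i, node Ny j) - c i (j + 1) (node Nx (i - 1), node Ny j)) / step Nx) / 2
      - (D (x, node Ny j) (u i j (x, node Ny j)) $ 2 $ 2
            * (c i j (x, node Ny j) - c i j (x, node Ny (j - 1))) / step Ny
         + D (x, node Ny j) (u i j (x, node Ny j)) $ 2 $ 1
            * (c i j (node Nx i, node Ny j) - c i j (node Nx (i - 1), node Ny j)) / step Nx) / 2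
      - \<alpha>' / step Nx * (c i (j + 1) (x, node Ny j) - c i j (x, node Ny j))"
proof -
  have j': "j \<in> {1..Ny}" "j + 1 \<in> {1..Ny}" "j \<noteq> 0" "j \<noteq> Ny"
    using j by auto
  show ?thesis
    using j'(3,4)
    by (simp add: num_flux_def uc_hat_def avg_def jump_def inner_axis add_divide_distrib
        diff_flux_component[OF c i j'(1)] diff_flux_component[OF c i j'(2)])
qed


text \<open>
  Both directions and both orientations of an edge are covered at once: \<open>own\<close> and \<open>nbr\<close> are the traces on the
  edge from inside and outside the cell, \<open>opp\<close> and \<open>nopp\<close> the values on the opposite edges of the two cells,
  \<open>s\<close>, \<open>t\<close>, \<open>s'\<close>, \<open>t'\<close> the end point values of the traces, and \<open>f\<close> is the flux out of the cell. The length of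
  the edge is \<open>k\<close>, the width of the cells across it is \<open>h\<close>.
  
  Values from the neighbour drop out of the bound. The penalty \<open>\<alpha>' / k\<close> on \<open>nbr\<close> absorbs the diffusive
  terms in \<open>nbr\<close>; the diagonal one is at most \<open>dM / (2 * h)\<close>, and the tangential difference quotient is
  controlled by \<open>\<bar>t' - s'\<bar> \<le> s' + t'\<close>, the sum over the two Gauss points. The other neighbour terms have
  a favourable sign.
\<close>

lemma outflow_bound:
  fixes own opp nbr nopp m m' dO aO dN aN :: "nat \<Rightarrow> real"
  assumes h: "h > 0" and k: "k > 0" and dM: "dM \<ge> 0" and aM: "aM \<ge> 0"
    and ends: "s \<ge> 0" "t \<ge> 0" "s + t = (\<Sum>b\<in>{1, 2}. own b)"
    and nends: "s' \<ge> 0" "t' \<ge> 0" "s' + t' = (\<Sum>b\<in>{1, 2}. nbr b)"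
    and nonneg: "\<And>b. b \<in> {1, 2} \<Longrightarrow> own b \<ge> 0 \<and> opp b \<ge> 0 \<and> nbr b \<ge> 0 \<and> nopp b \<ge> 0 \<and> m' b \<ge> 0"
    and d: "\<And>b. b \<in> {1, 2} \<Longrightarrow> 0 \<le> dO b \<and> dO b \<le> dM \<and> 0 \<le> dN b \<and> dN b \<le> dM"
    and a: "\<And>b. b \<in> {1, 2} \<Longrightarrow> \<bar>aO b\<bar> \<le> aM \<and> \<bar>aN b\<bar> \<le> aM"
    and pen: "k / (2 * h) * dM + sqrt 3 * aM \<le> \<alpha>'"
    and flux: "\<And>b. b \<in> {1, 2} \<Longrightarrow> f b = m b * own b - m' b * nbr b
        - (dO b * (own b - opp b) / h + aO b * (t - s) / k) / 2
        + (dN b * (nbr b - nopp b) / h + aN b * (t' - s') / k) / 2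
        - \<alpha>' / k * (nbr b - own b)"
  shows "(\<Sum>b\<in>{1, 2}. f b) \<le> (\<Sum>b\<in>{1, 2}. m b * own b)
      + dM / (2 * h) * (\<Sum>b\<in>{1, 2}. opp b) + (\<alpha>' + aM) / k * (\<Sum>b\<in>{1, 2}. own b)"
proof -
  \<comment> \<open>The factor \<open>2\<close> is cancelled by the averaging of the two one-sided diffusive fluxes.\<close>
  have halves: "dM / h * S = 2 * (dM / (2 * h) * S)" "2 * aM / k * S = 2 * (aM / k * S)" for S
    by simp_all
  have tang: "\<bar>\<Sum>b\<in>{1, 2}. a b * (t - s) / k\<bar> \<le> 2 * aM / k * (s + t)"
    if "\<And>b. b \<in> {1, 2} \<Longrightarrow> \<bar>a b\<bar> \<le> aM" and "s \<ge> 0" "t \<ge> 0" for a :: "nat \<Rightarrow> real" and s t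
  proof -
    have "\<bar>a 1 + a 2\<bar> * \<bar>t - s\<bar> \<le> (2 * aM) * (s + t)"
      using that(1)[of 1] that(1)[of 2] that(2,3) by (intro mult_mono) auto
    then have "\<bar>(a 1 + a 2) * (t - s) / k\<bar> \<le> 2 * aM * (s + t) / k"
      using k by (simp add: abs_mult divide_right_mono)
    then show ?thesis
      unfolding sum_gauss_points by (simp add: algebra_simps add_divide_distrib diff_divide_distrib)
  qed
  have "- (dO b * (own b - opp b) / h) \<le> dM / h * opp b" if "b \<in> {1, 2}" for b
  proof -
    have "dO b * opp b \<le> dM * opp b" "0 \<le> dO b * own b"
      using nonneg[OF that] d[OF that] by (auto intro: mult_right_mono)
    then have "- (dO b * (own b - opp b)) \<le> dM * opp b"
      by (simp add: algebra_simps)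
    then have "- (dO b * (own b - opp b)) / h \<le> dM * opp b / h"
      using h by (intro divide_right_mono) auto
    then show ?thesis by simp
  qed
  then have normal_own: "- (\<Sum>b\<in>{1, 2}. dO b * (own b - opp b) / h) \<le> dM / h * (\<Sum>b\<in>{1, 2}. opp b)"
    unfolding sum_negf[symmetric] sum_distrib_left by (rule sum_mono)
  have "dN b * (nbr b - nopp b) / h \<le> dM / h * nbr b" if "b \<in> {1, 2}" for b
  proof -
    have "dN b * nbr b \<le> dM * nbr b" "0 \<le> dN b * nopp b"
      using nonneg[OF that] d[OF that] by (auto intro: mult_right_mono)
    then have "dN b * (nbr b - nopp b) \<le> dM * nbr b"
      by (simp add: algebra_simps)
    then show ?thesis
      using h by (simp add: divide_right_mono)
  qed
  then have normal_nbr: "(\<Sum>b\<in>{1, 2}. dN b * (nbr b - nopp b) / h) \<le> dM / h * (\<Sum>b\<in>{1, 2}. nbr b)"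
    unfolding sum_distrib_left by (rule sum_mono)
  have conv: "0 \<le> (\<Sum>b\<in>{1, 2}. m' b * nbr b)"
    using nonneg by (intro sum_nonneg) auto
  \<comment> \<open>The tangential estimate produces \<open>aM\<close> with weight \<open>1\<close>.\<close>
  have "1 * aM \<le> sqrt 3 * aM"
    using aM by (intro mult_right_mono) auto
  then have "dM * k / (2 * h) + aM \<le> \<alpha>'"
    using pen by (simp add: mult.commute)
  then have "(dM * k / (2 * h) + aM) / k \<le> \<alpha>' / k"
    using k by (simp add: divide_right_mono)
  then have "dM / (2 * h) + aM / k \<le> \<alpha>' / k"
    using k by (simp add: add_divide_distrib)
  then have absorb: "(dM / (2 * h) + aM / k) * (\<Sum>b\<in>{1, 2}. nbr b) \<le> \<alpha>' / k * (\<Sum>b\<in>{1, 2}. nbr b)"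
    using nonneg by (intro mult_right_mono sum_nonneg) auto
  have "(\<Sum>b\<in>{1, 2}. f b) = (\<Sum>b\<in>{1, 2}. m b * own b) - (\<Sum>b\<in>{1, 2}. m' b * nbr b)
      - ((\<Sum>b\<in>{1, 2}. dO b * (own b - opp b) / h) + (\<Sum>b\<in>{1, 2}. aO b * (t - s) / k)) / 2
      + ((\<Sum>b\<in>{1, 2}. dN b * (nbr b - nopp b) / h) + (\<Sum>b\<in>{1, 2}. aN b * (t' - s') / k)) / 2
      - \<alpha>' / k * ((\<Sum>b\<in>{1, 2}. nbr b) - (\<Sum>b\<in>{1, 2}. own b))"
    unfolding sum_gauss_points flux[of 1, simplified] flux[of 2, simplified]
    by (simp add: add_divide_distrib diff_divide_distrib ring_distribs)
  moreover have "\<bar>\<Sum>b\<in>{1, 2}. aO b * (t - s) / k\<bar> \<le> 2 * aM / k * (\<Sum>b\<in>{1, 2}. own b)"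
    using tang[of aO s t] a ends by auto
  moreover have "\<bar>\<Sum>b\<in>{1, 2}. aN b * (t' - s') / k\<bar> \<le> 2 * aM / k * (\<Sum>b\<in>{1, 2}. nbr b)"
    using tang[of aN s' t'] a nends by auto
  moreover note normal_own normal_nbr conv absorb
  ultimately show ?thesis
    unfolding halves distrib_right right_diff_distrib[of "\<alpha>' / k"] add_divide_distrib by linarith
qed

text \<open>
  The suprema of the diffusion coefficients are extended reals. Both have positive weight in the time
  step condition, whose right-hand side is finite, so they are real numbers.
\<close>

lemma diffusion_constants:
  fixes X Y :: ereal
  assumes X: "0 \<le> X" and Y: "0 \<le> Y" and L: "0 < L" and lam: "0 < lam"
    and pen: "ereal \<alpha>' \<ge> ereal \<gamma> * X + ereal (sqrt 3) * Y"
    and cfl: "X * ereal L + 2 * (ereal \<alpha>' + Y) * ereal lam \<le> ereal K"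
  obtains dM aM where "X = ereal dM" "Y = ereal aM" "0 \<le> dM" "0 \<le> aM"
    "\<gamma> * dM + sqrt 3 * aM \<le> \<alpha>'" "dM * L + 2 * (\<alpha>' + aM) * lam \<le> K"
proof -
  have "0 \<le> X * ereal L"
    using X L by simp
  then have "Y \<noteq> \<infinity>"
    using cfl lam by auto
  then obtain aM where aM: "Y = ereal aM" using Y by (cases Y) auto
  have "X \<noteq> \<infinity>"
    using cfl L by (auto simp: aM)
  then obtain dM where dM: "X = ereal dM" using X by (cases X) auto
  have "2 * (ereal \<alpha>' + ereal aM) * ereal lam = ereal (2 * (\<alpha>' + aM) * lam)"
    by (metis numeral_eq_ereal plus_ereal.simps(1) times_ereal.simps(1))
  then show ?thesis
    using that[OF dM aM] assms by (simp add: dM aM)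
qed

section \<open>Positivity of the cell average\<close>

text \<open>
  The loss through a pair of opposite edges. Each edge charges its own Gauss values for convection,
  penalty and tangential diffusion, and the opposite ones for normal diffusion; adding the two edges
  makes the bound symmetric in them, and the sum of \<open>r\<close> over their four Gauss points is \<open>4 * A\<close>. For the convective part,
  \<open>6 * T * m * c \<le> r\<close> gives the fraction \<open>dt / h / (3 * T)\<close>, which adds up to \<open>1 / 3\<close> over both directions.
\<close>

lemma opposite_edges_loss:
  fixes E W rE rW mE mW :: "nat \<Rightarrow> real"
  assumes h: "h > 0" and k: "k > 0" and dt: "dt > 0" and T: "T > 0" and Pm: "Pm > 0"
    and QE: "QE \<le> (\<Sum>b\<in>{1, 2}. mE b * E b) + dM / (2 * h) * (\<Sum>b\<in>{1, 2}. W b)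
        + (\<alpha>' + aM) / k * (\<Sum>b\<in>{1, 2}. E b)"
    and QW: "QW \<le> (\<Sum>b\<in>{1, 2}. mW b * W b) + dM / (2 * h) * (\<Sum>b\<in>{1, 2}. E b)
        + (\<alpha>' + aM) / k * (\<Sum>b\<in>{1, 2}. W b)"
    and nonneg: "\<And>b. b \<in> {1, 2} \<Longrightarrow> 0 \<le> E b \<and> 0 \<le> W b"
    and conv: "\<And>b. b \<in> {1, 2} \<Longrightarrow> 6 * T * mE b * E b \<le> rE b \<and> 6 * T * mW b * W b \<le> rW b"
    and diff: "\<And>b. b \<in> {1, 2} \<Longrightarrow> Pm * E b \<le> rE b \<and> Pm * W b \<le> rW b"
    and cfl: "dM * (dt / h\<^sup>2) + 2 * (\<alpha>' + aM) * (dt / (h * k)) \<le> 1 / 12 * Pm"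
    and A: "4 * A = (\<Sum>b\<in>{1, 2}. rW b + rE b)"
  shows "dt / (h * k) * (k / 2 * (QE + QW)) \<le> dt / h / (3 * T) * A + A / 12"
proof -
  define S where "S = (\<Sum>b\<in>{1, 2}. E b) + (\<Sum>b\<in>{1, 2}. W b)"
  define M where "M = (\<Sum>b\<in>{1, 2}. mE b * E b) + (\<Sum>b\<in>{1, 2}. mW b * W b)"
  have "6 * T * M \<le> 4 * A"
    unfolding A M_def sum_gauss_points using conv[of 1] conv[of 2] by (simp add: algebra_simps)
  then have M: "M \<le> 2 * A / (3 * T)"
    using T by (simp add: field_simps)
  have PS: "Pm * S \<le> 4 * A"
    unfolding A S_def sum_gauss_points using diff[of 1] diff[of 2] by (simp add: algebra_simps)
  have S: "0 \<le> S"
    unfolding S_def using nonneg by (intro add_nonneg_nonneg sum_nonneg) auto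
  have "QE + QW \<le> M + (dM / (2 * h) + (\<alpha>' + aM) / k) * S"
    using QE QW by (simp add: M_def S_def ring_distribs)
  then have "dt / (h * k) * (k / 2 * (QE + QW))
      \<le> dt / (h * k) * (k / 2 * (M + (dM / (2 * h) + (\<alpha>' + aM) / k) * S))"
    using h k dt by (intro mult_left_mono) auto
  also have "\<dots> = dt / (2 * h) * M + (dM * (dt / h\<^sup>2) + 2 * (\<alpha>' + aM) * (dt / (h * k))) * S / 4"
    using h k by (simp add: field_simps power2_eq_square)
  also have "\<dots> \<le> dt / (2 * h) * (2 * A / (3 * T)) + 1 / 12 * Pm * S / 4"
    using M S cfl h dt by (intro add_mono mult_left_mono divide_right_mono mult_right_mono) auto
  also have "\<dots> \<le> dt / h / (3 * T) * A + A / 12"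
    using PS by simp
  finally show ?thesis .
qed

text \<open>
  The hypotheses on one time level that the outflow bounds use. The numbers \<open>d k\<close> and \<open>a k\<close> bound the diagonal
  and the off-diagonal entry of row \<open>k\<close> of the diffusion matrix, the row that enters the flux with
  normal direction \<open>k\<close>.
\<close>

locale positive_state =
  fixes Nx Ny :: nat and \<phi> :: "real \<times> real \<Rightarrow> real" and r :: "real cellfun"
    and D :: "real \<times> real \<Rightarrow> real ^ 2 \<Rightarrow> real ^ 2 ^ 2" and u :: "(real ^ 2) cellfun"
    and \<alpha> \<alpha>' :: real and d a :: "2 \<Rightarrow> real"
  assumes phi_pos: "\<forall>z\<in>Omega. \<phi> z > 0"
    and r_in_Wh: "r \<in> Wh Nx Ny"
    and r_pos: "\<lbrakk>i \<in> {1..Nx}; j \<in> {1..Ny}\<rbrakk> \<Longrightarrow> \<forall>z\<in>cell Nx Ny i j. r i j z > 0"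
    and D_diag: "\<lbrakk>i \<in> {1..Nx}; j \<in> {1..Ny}; z \<in> cell Nx Ny i j\<rbrakk>
       \<Longrightarrow> 0 \<le> D z (u i j z) $ k $ k \<and> D z (u i j z) $ k $ k \<le> d k"
    and D_off: "\<lbrakk>i \<in> {1..Nx}; j \<in> {1..Ny}; z \<in> cell Nx Ny i j; k \<noteq> l\<rbrakk>
       \<Longrightarrow> \<bar>D z (u i j z) $ k $ l\<bar> \<le> a k"
    and d_nonneg: "0 \<le> d k" and a_nonneg: "0 \<le> a k"
    and penalty_x: "step Ny / (2 * step Nx) * d 1 + sqrt 3 * a 1 \<le> \<alpha>'"
    and penalty_y: "step Nx / (2 * step Ny) * d 2 + sqrt 3 * a 2 \<le> \<alpha>'"
    and alpha_nonneg: "0 \<le> \<alpha>"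
begin

abbreviation c :: "real cellfun" where
  "c \<equiv> conc Nx Ny \<phi> r"

abbreviation flux :: "edge \<Rightarrow> real \<times> real \<Rightarrow> real" where
  "flux \<equiv> num_flux Nx Ny D \<alpha> \<alpha>' u c"

lemma c_nonneg:
  assumes "i \<in> {1..Nx}" "j \<in> {1..Ny}" "z \<in> cell Nx Ny i j"
  shows "0 \<le> c i j z"
  by (rule conc_nonneg[where i = i and j = j and r = r, OF phi_pos r_pos[OF assms(1,2)] assms])

lemma vert_trace_in_cell:
  assumes "i \<in> {1..Nx}" "j \<in> {1..Ny}" "k \<in> {i - 1, i}"
  shows "(node Nx k, gauss Ny j b) \<in> cell Nx Ny i j"
  using node_in_interval[of Nx i k] gauss_in_interval[of Ny j b] assms
  by (auto simp: cell_def intro: less_imp_le)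

lemma horiz_trace_in_cell:
  assumes "i \<in> {1..Nx}" "j \<in> {1..Ny}" "l \<in> {j - 1, j}"
  shows "(gauss Nx i b, node Ny l) \<in> cell Nx Ny i j"
  using node_in_interval[of Ny j l] gauss_in_interval[of Nx i b] assms
  by (auto simp: cell_def intro: less_imp_le)

text \<open>
  The convective flux out of a cell is \<open>\<alpha> c\<^sup>- - (\<alpha> - u\<^sup>+) c\<^sup>+\<close> through the right edge, where \<open>c\<^sup>-\<close> is the inner
  trace, and \<open>(\<alpha> - u\<^sup>+) c\<^sup>+ - \<alpha> c\<^sup>-\<close> through the left edge, where \<open>c\<^sup>+\<close> is. Hence the inner coefficients
  are \<open>\<alpha>\<close> on the right and \<open>\<alpha> - u\<^sup>+\<close> on the left, and the outer one, which is
  subtracted, is nonnegative on the right if \<open>u\<^sup>+ \<le> \<alpha>\<close>. The signs of the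
  off-diagonal coefficients depend on whether the outward direction agrees with the normal. The lemmas for the upper and the lower edge mirror this.
\<close>

lemma outflow_east:
  assumes i: "1 \<le> i" "i < Nx" and j: "j \<in> {1..Ny}"
    and u: "\<And>b. b \<in> {1, 2} \<Longrightarrow> u1_plus Nx Ny u i j b \<le> \<alpha>"
  shows "(\<Sum>b\<in>{1, 2}. flux (Vert i j) (edge_pt Nx Ny (Vert i j) b))
    \<le> (\<Sum>b\<in>{1, 2}. \<alpha> * c i j (node Nx i, gauss Ny j b))
      + d 1 / (2 * step Nx) * (\<Sum>b\<in>{1, 2}. c i j (node Nx (i - 1), gauss Ny j b))
      + (\<alpha>' + a 1) / step Ny * (\<Sum>b\<in>{1, 2}. c i j (node Nx i, gauss Ny j b))"
proof -
  have ij: "i \<in> {1..Nx}" "i + 1 \<in> {1..Nx}" "i \<in> {1..<Nx}" "i \<noteq> Nx"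
    using i by auto
  have pos: "step Nx > 0" "step Ny > 0"
    using i j step_pos by auto
  let ?z = "\<lambda>b. (node Nx i, gauss Ny j b)"
  have own: "?z b \<in> cell Nx Ny i j" "(node Nx (i - 1), gauss Ny j b) \<in> cell Nx Ny i j"
    and nbr: "?z b \<in> cell Nx Ny (i + 1) j" "(node Nx (i + 1), gauss Ny j b) \<in> cell Nx Ny (i + 1) j" for b
    using vert_trace_in_cell[OF ij(1) j] vert_trace_in_cell[OF ij(2) j] by auto
  have up: "u1_plus Nx Ny u i j b = u (i + 1) j (?z b) $ 1" for b
    using ij by (simp add: u1_plus_def)
  show ?thesis
  proof (rule outflow_bound[where h = "step Nx" and k = "step Ny" and dM = "d 1" and aM = "a 1" and \<alpha>' = \<alpha>'
        and nbr = "\<lambda>b. c (i + 1) j (?z b)" and nopp = "\<lambda>b. c (i + 1) j (node Nx (i + 1), gauss Ny j b)"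
        and m' = "\<lambda>b. \<alpha> - u1_plus Nx Ny u i j b"
        and dO = "\<lambda>b. D (?z b) (u i j (?z b)) $ 1 $ 1" and dN = "\<lambda>b. D (?z b) (u (i + 1) j (?z b)) $ 1 $ 1"
        and aO = "\<lambda>b. D (?z b) (u i j (?z b)) $ 1 $ 2" and aN = "\<lambda>b. - D (?z b) (u (i + 1) j (?z b)) $ 1 $ 2"
        and s = "c i j (node Nx i, node Ny (j - 1))" and t = "c i j (node Nx i, node Ny j)"
        and s' = "c (i + 1) j (node Nx i, node Ny (j - 1))" and t' = "c (i + 1) j (node Nx i, node Ny j)",
        OF pos d_nonneg a_nonneg _ _ Wh_edge_gauss_sum(1)[OF conc_in_Wh ij(1) j] _ _
           Wh_edge_gauss_sum(1)[OF conc_in_Wh ij(2) j]])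
    show "step Ny / (2 * step Nx) * d 1 + sqrt 3 * a 1 \<le> \<alpha>'"
      by (rule penalty_x)
  next
    fix b :: nat assume b: "b \<in> {1, 2}"
    show "0 \<le> c i j (?z b) \<and> 0 \<le> c i j (node Nx (i - 1), gauss Ny j b) \<and> 0 \<le> c (i + 1) j (?z b)
        \<and> 0 \<le> c (i + 1) j (node Nx (i + 1), gauss Ny j b) \<and> 0 \<le> \<alpha> - u1_plus Nx Ny u i j b"
      using c_nonneg ij j own nbr u[OF b] by simp
    show "flux (Vert i j) (edge_pt Nx Ny (Vert i j) b) =
        \<alpha> * c i j (?z b) - (\<alpha> - u1_plus Nx Ny u i j b) * c (i + 1) j (?z b)
        - (D (?z b) (u i j (?z b)) $ 1 $ 1 * (c i j (?z b) - c i j (node Nx (i - 1), gauss Ny j b)) / step Nx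
           + D (?z b) (u i j (?z b)) $ 1 $ 2
             * (c i j (node Nx i, node Ny j) - c i j (node Nx i, node Ny (j - 1))) / step Ny) / 2
        + (D (?z b) (u (i + 1) j (?z b)) $ 1 $ 1
             * (c (i + 1) j (?z b) - c (i + 1) j (node Nx (i + 1), gauss Ny j b)) / step Nx
           + - D (?z b) (u (i + 1) j (?z b)) $ 1 $ 2
             * (c (i + 1) j (node Nx i, node Ny j) - c (i + 1) j (node Nx i, node Ny (j - 1))) / step Ny) / 2
        - \<alpha>' / step Ny * (c (i + 1) j (?z b) - c i j (?z b))"
      unfolding edge_pt.simps num_flux_Vert[OF conc_in_Wh ij(3) j] up
      by (simp add: ring_distribs add_divide_distrib diff_divide_distrib)
  qed (use D_diag D_off ij j own nbr c_nonneg node_in_cell[OF ij(1) j] node_in_cell[OF ij(2) j] in auto)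
qed

lemma outflow_west:
  assumes i: "1 < i" "i \<le> Nx" and j: "j \<in> {1..Ny}"
  shows "- (\<Sum>b\<in>{1, 2}. flux (Vert (i - 1) j) (edge_pt Nx Ny (Vert (i - 1) j) b))
    \<le> (\<Sum>b\<in>{1, 2}. (\<alpha> - u1_plus Nx Ny u (i - 1) j b) * c i j (node Nx (i - 1), gauss Ny j b))
      + d 1 / (2 * step Nx) * (\<Sum>b\<in>{1, 2}. c i j (node Nx i, gauss Ny j b))
      + (\<alpha>' + a 1) / step Ny * (\<Sum>b\<in>{1, 2}. c i j (node Nx (i - 1), gauss Ny j b))"
proof -
  \<comment> \<open>The right-hand neighbour of the edge \<open>Vert w j\<close> is the cell itself.\<close>
  define w where "w = i - 1"
  have i_eq: "i = w + 1" "w = i - 1"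
    using i by (auto simp: w_def)
  have ij: "i \<in> {1..Nx}" "w \<in> {1..Nx}" "w \<in> {1..<Nx}" "w \<noteq> Nx"
    using i by (auto simp: w_def)
  have pos: "step Nx > 0" "step Ny > 0"
    using i j step_pos by auto
  let ?z = "\<lambda>b. (node Nx w, gauss Ny j b)"
  have own: "?z b \<in> cell Nx Ny i j" "(node Nx i, gauss Ny j b) \<in> cell Nx Ny i j"
    and nbr: "?z b \<in> cell Nx Ny w j" "(node Nx (w - 1), gauss Ny j b) \<in> cell Nx Ny w j" for b
    using vert_trace_in_cell[OF ij(1) j] vert_trace_in_cell[OF ij(2) j] by (auto simp: w_def)
  have up: "u1_plus Nx Ny u w j b = u i j (?z b) $ 1" for b
    using ij by (simp add: u1_plus_def i_eq(1))
  show ?thesis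
    unfolding i_eq(2)[symmetric] sum_negf[symmetric]
  proof (rule outflow_bound[where h = "step Nx" and k = "step Ny" and dM = "d 1" and aM = "a 1" and \<alpha>' = \<alpha>'
        and nbr = "\<lambda>b. c w j (?z b)" and nopp = "\<lambda>b. c w j (node Nx (w - 1), gauss Ny j b)"
        and m' = "\<lambda>b. \<alpha>"
        and dO = "\<lambda>b. D (?z b) (u i j (?z b)) $ 1 $ 1" and dN = "\<lambda>b. D (?z b) (u w j (?z b)) $ 1 $ 1"
        and aO = "\<lambda>b. - D (?z b) (u i j (?z b)) $ 1 $ 2" and aN = "\<lambda>b. D (?z b) (u w j (?z b)) $ 1 $ 2"
        and s = "c i j (node Nx w, node Ny (j - 1))" and t = "c i j (node Nx w, node Ny j)"
        and s' = "c w j (node Nx w, node Ny (j - 1))" and t' = "c w j (node Nx w, node Ny j)",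
        OF pos d_nonneg a_nonneg _ _ Wh_edge_gauss_sum(1)[OF conc_in_Wh ij(1) j] _ _
           Wh_edge_gauss_sum(1)[OF conc_in_Wh ij(2) j]])
    show "step Ny / (2 * step Nx) * d 1 + sqrt 3 * a 1 \<le> \<alpha>'"
      by (rule penalty_x)
  next
    fix b :: nat assume b: "b \<in> {1, 2}"
    show "0 \<le> c i j (?z b) \<and> 0 \<le> c i j (node Nx i, gauss Ny j b) \<and> 0 \<le> c w j (?z b)
        \<and> 0 \<le> c w j (node Nx (w - 1), gauss Ny j b) \<and> 0 \<le> \<alpha>"
      using c_nonneg ij j own nbr alpha_nonneg by simp
    show "- flux (Vert w j) (edge_pt Nx Ny (Vert w j) b) =
        (\<alpha> - u1_plus Nx Ny u w j b) * c i j (?z b) - \<alpha> * c w j (?z b)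
        - (D (?z b) (u i j (?z b)) $ 1 $ 1 * (c i j (?z b) - c i j (node Nx i, gauss Ny j b)) / step Nx
           + - D (?z b) (u i j (?z b)) $ 1 $ 2
             * (c i j (node Nx w, node Ny j) - c i j (node Nx w, node Ny (j - 1))) / step Ny) / 2
        + (D (?z b) (u w j (?z b)) $ 1 $ 1 * (c w j (?z b) - c w j (node Nx (w - 1), gauss Ny j b)) / step Nx
           + D (?z b) (u w j (?z b)) $ 1 $ 2
             * (c w j (node Nx w, node Ny j) - c w j (node Nx w, node Ny (j - 1))) / step Ny) / 2
        - \<alpha>' / step Ny * (c w j (?z b) - c i j (?z b))"
      unfolding edge_pt.simps num_flux_Vert[OF conc_in_Wh ij(3) j] up i_eq(1)[symmetric]
      by (simp add: ring_distribs add_divide_distrib diff_divide_distrib)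
  qed (use D_diag D_off ij j own nbr c_nonneg node_in_cell[OF ij(1) j] node_in_cell[OF ij(2) j] w_def in auto)
qed

lemma outflow_north:
  assumes i: "i \<in> {1..Nx}" and j: "1 \<le> j" "j < Ny"
    and u: "\<And>b. b \<in> {1, 2} \<Longrightarrow> u2_plus Nx Ny u i j b \<le> \<alpha>"
  shows "(\<Sum>b\<in>{1, 2}. flux (Horiz i j) (edge_pt Nx Ny (Horiz i j) b))
    \<le> (\<Sum>b\<in>{1, 2}. \<alpha> * c i j (gauss Nx i b, node Ny j))
      + d 2 / (2 * step Ny) * (\<Sum>b\<in>{1, 2}. c i j (gauss Nx i b, node Ny (j - 1)))
      + (\<alpha>' + a 2) / step Nx * (\<Sum>b\<in>{1, 2}. c i j (gauss Nx i b, node Ny j))"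
proof -
  have ij: "j \<in> {1..Ny}" "j + 1 \<in> {1..Ny}" "j \<in> {1..<Ny}" "j \<noteq> Ny"
    using j by auto
  have pos: "step Nx > 0" "step Ny > 0"
    using i j step_pos by auto
  let ?z = "\<lambda>b. (gauss Nx i b, node Ny j)"
  have own: "?z b \<in> cell Nx Ny i j" "(gauss Nx i b, node Ny (j - 1)) \<in> cell Nx Ny i j"
    and nbr: "?z b \<in> cell Nx Ny i (j + 1)" "(gauss Nx i b, node Ny (j + 1)) \<in> cell Nx Ny i (j + 1)" for b
    using horiz_trace_in_cell[OF i ij(1)] horiz_trace_in_cell[OF i ij(2)] by auto
  have up: "u2_plus Nx Ny u i j b = u i (j + 1) (?z b) $ 2" for b
    using ij by (simp add: u2_plus_def)
  show ?thesis
  proof (rule outflow_bound[where h = "step Ny" and k = "step Nx" and dM = "d 2" and aM = "a 2" and \<alpha>' = \<alpha>'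
        and nbr = "\<lambda>b. c i (j + 1) (?z b)" and nopp = "\<lambda>b. c i (j + 1) (gauss Nx i b, node Ny (j + 1))"
        and m' = "\<lambda>b. \<alpha> - u2_plus Nx Ny u i j b"
        and dO = "\<lambda>b. D (?z b) (u i j (?z b)) $ 2 $ 2" and dN = "\<lambda>b. D (?z b) (u i (j + 1) (?z b)) $ 2 $ 2"
        and aO = "\<lambda>b. D (?z b) (u i j (?z b)) $ 2 $ 1" and aN = "\<lambda>b. - D (?z b) (u i (j + 1) (?z b)) $ 2 $ 1"
        and s = "c i j (node Nx (i - 1), node Ny j)" and t = "c i j (node Nx i, node Ny j)"
        and s' = "c i (j + 1) (node Nx (i - 1), node Ny j)" and t' = "c i (j + 1) (node Nx i, node Ny j)",
        OF pos(2,1) d_nonneg a_nonneg _ _ Wh_edge_gauss_sum(2)[OF conc_in_Wh i ij(1)] _ _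
           Wh_edge_gauss_sum(2)[OF conc_in_Wh i ij(2)]])
    show "step Nx / (2 * step Ny) * d 2 + sqrt 3 * a 2 \<le> \<alpha>'"
      by (rule penalty_y)
  next
    fix b :: nat assume b: "b \<in> {1, 2}"
    show "0 \<le> c i j (?z b) \<and> 0 \<le> c i j (gauss Nx i b, node Ny (j - 1)) \<and> 0 \<le> c i (j + 1) (?z b)
        \<and> 0 \<le> c i (j + 1) (gauss Nx i b, node Ny (j + 1)) \<and> 0 \<le> \<alpha> - u2_plus Nx Ny u i j b"
      using c_nonneg i ij own nbr u[OF b] by simp
    show "flux (Horiz i j) (edge_pt Nx Ny (Horiz i j) b) =
        \<alpha> * c i j (?z b) - (\<alpha> - u2_plus Nx Ny u i j b) * c i (j + 1) (?z b)
        - (D (?z b) (u i j (?z b)) $ 2 $ 2 * (c i j (?z b) - c i j (gauss Nx i b, node Ny (j - 1))) / step Ny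
           + D (?z b) (u i j (?z b)) $ 2 $ 1
             * (c i j (node Nx i, node Ny j) - c i j (node Nx (i - 1), node Ny j)) / step Nx) / 2
        + (D (?z b) (u i (j + 1) (?z b)) $ 2 $ 2
             * (c i (j + 1) (?z b) - c i (j + 1) (gauss Nx i b, node Ny (j + 1))) / step Ny
           + - D (?z b) (u i (j + 1) (?z b)) $ 2 $ 1
             * (c i (j + 1) (node Nx i, node Ny j) - c i (j + 1) (node Nx (i - 1), node Ny j)) / step Nx) / 2
        - \<alpha>' / step Nx * (c i (j + 1) (?z b) - c i j (?z b))"
      unfolding edge_pt.simps num_flux_Horiz[OF conc_in_Wh i ij(3)] up
      by (simp add: ring_distribs add_divide_distrib diff_divide_distrib)
  qed (use D_diag D_off i ij own nbr c_nonneg node_in_cell[OF i ij(1)] node_in_cell[OF i ij(2)] in auto)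
qed

lemma outflow_south:
  assumes i: "i \<in> {1..Nx}" and j: "1 < j" "j \<le> Ny"
  shows "- (\<Sum>b\<in>{1, 2}. flux (Horiz i (j - 1)) (edge_pt Nx Ny (Horiz i (j - 1)) b))
    \<le> (\<Sum>b\<in>{1, 2}. (\<alpha> - u2_plus Nx Ny u i (j - 1) b) * c i j (gauss Nx i b, node Ny (j - 1)))
      + d 2 / (2 * step Ny) * (\<Sum>b\<in>{1, 2}. c i j (gauss Nx i b, node Ny j))
      + (\<alpha>' + a 2) / step Nx * (\<Sum>b\<in>{1, 2}. c i j (gauss Nx i b, node Ny (j - 1)))"
proof -
  \<comment> \<open>The upper neighbour of the edge \<open>Horiz i w\<close> is the cell itself.\<close>
  define w where "w = j - 1"
  have j_eq: "j = w + 1" "w = j - 1"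
    using j by (auto simp: w_def)
  have ij: "j \<in> {1..Ny}" "w \<in> {1..Ny}" "w \<in> {1..<Ny}" "w \<noteq> Ny"
    using j by (auto simp: w_def)
  have pos: "step Nx > 0" "step Ny > 0"
    using i j step_pos by auto
  let ?z = "\<lambda>b. (gauss Nx i b, node Ny w)"
  have own: "?z b \<in> cell Nx Ny i j" "(gauss Nx i b, node Ny j) \<in> cell Nx Ny i j"
    and nbr: "?z b \<in> cell Nx Ny i w" "(gauss Nx i b, node Ny (w - 1)) \<in> cell Nx Ny i w" for b
    using horiz_trace_in_cell[OF i ij(1)] horiz_trace_in_cell[OF i ij(2)] by (auto simp: w_def)
  have up: "u2_plus Nx Ny u i w b = u i j (?z b) $ 2" for b
    using ij by (simp add: u2_plus_def j_eq(1))
  show ?thesis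
    unfolding j_eq(2)[symmetric] sum_negf[symmetric]
  proof (rule outflow_bound[where h = "step Ny" and k = "step Nx" and dM = "d 2" and aM = "a 2" and \<alpha>' = \<alpha>'
        and nbr = "\<lambda>b. c i w (?z b)" and nopp = "\<lambda>b. c i w (gauss Nx i b, node Ny (w - 1))"
        and m' = "\<lambda>b. \<alpha>"
        and dO = "\<lambda>b. D (?z b) (u i j (?z b)) $ 2 $ 2" and dN = "\<lambda>b. D (?z b) (u i w (?z b)) $ 2 $ 2"
        and aO = "\<lambda>b. - D (?z b) (u i j (?z b)) $ 2 $ 1" and aN = "\<lambda>b. D (?z b) (u i w (?z b)) $ 2 $ 1"
        and s = "c i j (node Nx (i - 1), node Ny w)" and t = "c i j (node Nx i, node Ny w)"
        and s' = "c i w (node Nx (i - 1), node Ny w)" and t' = "c i w (node Nx i, node Ny w)",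
        OF pos(2,1) d_nonneg a_nonneg _ _ Wh_edge_gauss_sum(2)[OF conc_in_Wh i ij(1)] _ _
           Wh_edge_gauss_sum(2)[OF conc_in_Wh i ij(2)]])
    show "step Nx / (2 * step Ny) * d 2 + sqrt 3 * a 2 \<le> \<alpha>'"
      by (rule penalty_y)
  next
    fix b :: nat assume b: "b \<in> {1, 2}"
    show "0 \<le> c i j (?z b) \<and> 0 \<le> c i j (gauss Nx i b, node Ny j) \<and> 0 \<le> c i w (?z b)
        \<and> 0 \<le> c i w (gauss Nx i b, node Ny (w - 1)) \<and> 0 \<le> \<alpha>"
      using c_nonneg i ij own nbr alpha_nonneg by simp
    show "- flux (Horiz i w) (edge_pt Nx Ny (Horiz i w) b) =
        (\<alpha> - u2_plus Nx Ny u i w b) * c i j (?z b) - \<alpha> * c i w (?z b)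
        - (D (?z b) (u i j (?z b)) $ 2 $ 2 * (c i j (?z b) - c i j (gauss Nx i b, node Ny j)) / step Ny
           + - D (?z b) (u i j (?z b)) $ 2 $ 1
             * (c i j (node Nx i, node Ny w) - c i j (node Nx (i - 1), node Ny w)) / step Nx) / 2
        + (D (?z b) (u i w (?z b)) $ 2 $ 2 * (c i w (?z b) - c i w (gauss Nx i b, node Ny (w - 1))) / step Ny
           + D (?z b) (u i w (?z b)) $ 2 $ 1
             * (c i w (node Nx i, node Ny w) - c i w (node Nx (i - 1), node Ny w)) / step Nx) / 2
        - \<alpha>' / step Nx * (c i w (?z b) - c i j (?z b))"
      unfolding edge_pt.simps num_flux_Horiz[OF conc_in_Wh i ij(3)] up j_eq(1)[symmetric]
      by (simp add: ring_distribs add_divide_distrib diff_divide_distrib)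
  qed (use D_diag D_off i ij own nbr c_nonneg node_in_cell[OF i ij(1)] node_in_cell[OF i ij(2)] w_def in auto)
qed

end

lemma Phi_min_bounds:
  assumes "\<forall>z\<in>Omega. \<phi> z > 0" "Nx \<ge> 1" "Ny \<ge> 1"
  shows "0 < Phi_min Nx Ny \<phi>"
    and "\<lbrakk>k \<le> Nx; l \<le> Ny\<rbrakk> \<Longrightarrow> Phi_min Nx Ny \<phi> \<le> Phi_node Nx Ny \<phi> k l"
proof -
  let ?S = "{Phi_node Nx Ny \<phi> i j | i j. i \<in> {0..Nx} \<and> j \<in> {0..Ny}}"
  have fin: "finite ?S"
    by (rule finite_image_set2) auto
  have "?S \<noteq> {}" by auto
  then show "0 < Phi_min Nx Ny \<phi>"
    unfolding Phi_min_def using fin Phi_node_pos[OF assms(2,3,1)] by (subst Min_gr_iff) auto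
  show "\<lbrakk>k \<le> Nx; l \<le> Ny\<rbrakk> \<Longrightarrow> Phi_min Nx Ny \<phi> \<le> Phi_node Nx Ny \<phi> k l"
    unfolding Phi_min_def by (intro Min_le fin) auto
qed

context positive_state
begin

text \<open>
  All requirements on the data in real numbers and at one cell: the six conditions on \<open>T\<close>, the diffusion
  constants and the source are what the time step restrictions amount to there.
\<close>

lemma next_avg_pos:
  assumes eq: "conc_eq Nx Ny z1 q ct D \<alpha> \<alpha>' r c u pt (\<lambda>i j z. (r' i j z - r i j z) / dt)"
    and r': "r' \<in> Wh Nx Ny" and dt: "dt > 0" and i: "1 < i" "i < Nx" and j: "1 < j" "j < Ny"
    and T: "T = dt / step Nx + dt / step Ny"
    and u_le: "\<And>b. b \<in> {1, 2} \<Longrightarrow> u1_plus Nx Ny u i j b \<le> \<alpha> \<and> u2_plus Nx Ny u i j b \<le> \<alpha>"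
    and cfl_\<alpha>: "6 * T * \<alpha> \<le> Phi_min Nx Ny \<phi>"
    and cfl_u1: "\<And>b l. \<lbrakk>b \<in> {1, 2}; l \<in> {j - 1, j}\<rbrakk>
          \<Longrightarrow> 6 * T * (\<alpha> - u1_plus Nx Ny u (i - 1) j b) \<le> Phi_node Nx Ny \<phi> (i - 1) l"
    and cfl_u2: "\<And>b k. \<lbrakk>b \<in> {1, 2}; k \<in> {i - 1, i}\<rbrakk>
          \<Longrightarrow> 6 * T * (\<alpha> - u2_plus Nx Ny u i (j - 1) b) \<le> Phi_node Nx Ny \<phi> k (j - 1)"
    and cfl_x: "d 1 * (dt / (step Nx)\<^sup>2) + 2 * (\<alpha>' + a 1) * (dt / (step Nx * step Ny)) \<le> 1 / 12 * Phi_min Nx Ny \<phi>"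
    and cfl_y: "d 2 * (dt / (step Ny)\<^sup>2) + 2 * (\<alpha>' + a 2) * (dt / (step Nx * step Ny)) \<le> 1 / 12 * Phi_min Nx Ny \<phi>"
    and source: "\<And>b g. \<lbrakk>b \<in> {1, 2}; g \<in> {1, 2}\<rbrakk> \<Longrightarrow>
       dt * (ct (gauss Nx i b, gauss Ny j g) * q (gauss Nx i b, gauss Ny j g)
         - r i j (gauss Nx i b, gauss Ny j g) * z1 * pt i j (gauss Nx i b, gauss Ny j g))
       \<ge> - (1 / 3) * r i j (gauss Nx i b, gauss Ny j g)"
  shows "cell_avg Nx Ny r' i j > 0"
proof -
  have ij: "i \<in> {1..Nx}" "j \<in> {1..Ny}"
    using i j by auto
  have pos: "step Nx > 0" "step Ny > 0"
    using ij step_pos by auto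
  have Tpos: "T > 0"
    using pos dt by (simp add: T add_pos_pos)
  have Phi: "0 < Phi_min Nx Ny \<phi>"
    and Phi_le: "\<And>k l. \<lbrakk>k \<le> Nx; l \<le> Ny\<rbrakk> \<Longrightarrow> Phi_min Nx Ny \<phi> \<le> Phi_node Nx Ny \<phi> k l"
    using Phi_min_bounds[OF phi_pos] ij by auto
  define A where "A = cell_avg Nx Ny r i j"
  note A_sums = Wh_cell_avg[OF r_in_Wh ij, folded A_def]
  note rp = r_pos[OF ij]
  have vert: "m * c i j (node Nx k, gauss Ny j b) \<le> r i j (node Nx k, gauss Ny j b)"
    if "k \<in> {i - 1, i}" "\<forall>l\<in>{j - 1, j}. m \<le> Phi_node Nx Ny \<phi> k l" for m k b
    using gauss_in_interval[of Ny j b] ij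
    by (intro scaled_conc_le_vert phi_pos r_in_Wh rp that) auto
  have horiz: "m * c i j (gauss Nx i b, node Ny l) \<le> r i j (gauss Nx i b, node Ny l)"
    if "l \<in> {j - 1, j}" "\<forall>k\<in>{i - 1, i}. m \<le> Phi_node Nx Ny \<phi> k l" for m l b
    using gauss_in_interval[of Nx i b] ij
    by (intro scaled_conc_le_horiz phi_pos r_in_Wh rp that) auto
  have Phi_corner: "Phi_min Nx Ny \<phi> \<le> Phi_node Nx Ny \<phi> k l" "6 * T * \<alpha> \<le> Phi_node Nx Ny \<phi> k l"
    if "k \<in> {i - 1, i}" "l \<in> {j - 1, j}" for k l
  proof -
    have "k \<le> Nx" "l \<le> Ny"
      using that ij by auto
    then show "Phi_min Nx Ny \<phi> \<le> Phi_node Nx Ny \<phi> k l"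
      by (rule Phi_le)
    with cfl_\<alpha> show "6 * T * \<alpha> \<le> Phi_node Nx Ny \<phi> k l"
      by linarith
  qed
  let ?QE = "\<Sum>b\<in>{1, 2}. flux (Vert i j) (edge_pt Nx Ny (Vert i j) b)"
  let ?QW = "- (\<Sum>b\<in>{1, 2}. flux (Vert (i - 1) j) (edge_pt Nx Ny (Vert (i - 1) j) b))"
  let ?QN = "\<Sum>b\<in>{1, 2}. flux (Horiz i j) (edge_pt Nx Ny (Horiz i j) b)"
  let ?QS = "- (\<Sum>b\<in>{1, 2}. flux (Horiz i (j - 1)) (edge_pt Nx Ny (Horiz i (j - 1)) b))"
  have loss_x: "dt / (step Nx * step Ny) * (step Ny / 2 * (?QE + ?QW)) \<le> dt / step Nx / (3 * T) * A + A / 12"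
    using cfl_x vert Phi_corner cfl_u1 c_nonneg[OF ij] vert_trace_in_cell[OF ij] u_le i
    by (intro opposite_edges_loss[OF pos dt Tpos Phi outflow_east[OF _ i(2) ij(2)] outflow_west[OF i(1) _ ij(2)]
          _ _ _ _ A_sums(1)]) auto
  have loss_y: "dt / (step Ny * step Nx) * (step Nx / 2 * (?QN + ?QS)) \<le> dt / step Ny / (3 * T) * A + A / 12"
    using cfl_y horiz Phi_corner cfl_u2 c_nonneg[OF ij] horiz_trace_in_cell[OF ij] u_le j
    by (intro opposite_edges_loss[OF pos(2,1) dt Tpos Phi outflow_north[OF ij(1) _ j(2)] outflow_south[OF ij(1) j(1)]
          _ _ _ _ A_sums(2)]) (auto simp: mult.commute[of "step Ny"])
  let ?z = "\<lambda>b g. (gauss Nx i b, gauss Ny j g)"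
  let ?s = "\<lambda>b g. ct (?z b g) * q (?z b g) - r i j (?z b g) * z1 * pt i j (?z b g)"
  have "- (1 / 3) * (4 * A) \<le> dt * (\<Sum>b\<in>{1, 2}. \<Sum>g\<in>{1, 2}. ?s b g)"
    unfolding A_sums(3) sum_distrib_left by (intro sum_mono source)
  then have source_total: "- (A / 3) \<le> dt / 4 * (\<Sum>b\<in>{1, 2}. \<Sum>g\<in>{1, 2}. ?s b g)"
    by simp
  have "r i j (?z b g) > 0" for b g
    using rp gauss_in_interval[of Nx i b] gauss_in_interval[of Ny j g] ij
    by (auto simp: cell_def intro: less_imp_le)
  then have "0 < 4 * A"
    unfolding A_sums(3) sum_gauss_points by (intro add_pos_pos)
  then have A_pos: "A > 0"
    by simp
  \<comment> \<open>\<open>?QW\<close> and \<open>?QS\<close> carry a minus sign, so all four sums are outflows.\<close>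
  have "step Nx * step Ny * (cell_avg Nx Ny r' i j - A) / dt
      = step Nx * step Ny / 4 * (\<Sum>b\<in>{1, 2}. \<Sum>g\<in>{1, 2}. ?s b g)
        - step Ny / 2 * (?QE + ?QW) - step Nx / 2 * (?QN + ?QS)"
    unfolding A_def cell_balance[OF eq r_in_Wh r' i j] edge_quad_def len.simps by (simp add: algebra_simps)
  then have "cell_avg Nx Ny r' i j = A + dt / (step Nx * step Ny) *
      (step Nx * step Ny / 4 * (\<Sum>b\<in>{1, 2}. \<Sum>g\<in>{1, 2}. ?s b g)
        - step Ny / 2 * (?QE + ?QW) - step Nx / 2 * (?QN + ?QS))"
    using pos dt by (simp add: field_simps)
  also have "\<dots> = A + dt / 4 * (\<Sum>b\<in>{1, 2}. \<Sum>g\<in>{1, 2}. ?s b g)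
      - dt / (step Nx * step Ny) * (step Ny / 2 * (?QE + ?QW))
      - dt / (step Ny * step Nx) * (step Nx / 2 * (?QN + ?QS))"
    using pos by (simp add: right_diff_distrib mult.commute[of "step Ny"])
  also have "\<dots> \<ge> A - A / 3 - (dt / step Nx / (3 * T) * A + A / 12) - (dt / step Ny / (3 * T) * A + A / 12)"
    using source_total loss_x loss_y by linarith
  also (xtrans) have "A - A / 3 - (dt / step Nx / (3 * T) * A + A / 12) - (dt / step Ny / (3 * T) * A + A / 12)
      = A / 2 - (dt / step Nx + dt / step Ny) / (3 * T) * A"
    by (simp add: add_divide_distrib ring_distribs)
  also have "\<dots> = A / 6"
    using Tpos by (simp add: T[symmetric])
  finally show ?thesis
    using A_pos by linarith
qed

end

section \<open>Reading off the hypotheses\<close>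

lemma D_diag_max_upper:
  assumes "i \<in> {1..Nx}" "j \<in> {1..Ny}" "z \<in> cell Nx Ny i j"
  shows "ereal (D z (u i j z) $ k $ k) \<le> D_diag_max Nx Ny D u k"
  unfolding D_diag_max_def
  by (rule SUP_upper2[OF assms(1)], rule SUP_upper2[OF assms(2)], rule SUP_upper[OF assms(3)])

lemma D_off_max_upper:
  assumes "i \<in> {1..Nx}" "j \<in> {1..Ny}" "z \<in> cell Nx Ny i j"
  shows "ereal \<bar>D z (u i j z) $ k $ l\<bar> \<le> D_off_max Nx Ny D u k l"
  unfolding D_off_max_def
  by (rule SUP_upper2[OF assms(1)], rule SUP_upper2[OF assms(2)], rule SUP_upper[OF assms(3)])

lemma psd_diag_nonneg:
  fixes M :: "real ^ 'n ^ 'n"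
  assumes "\<forall>w. w \<bullet> (M *v w) \<ge> 0"
  shows "0 \<le> M $ k $ k"
  using assms[rule_format, of "axis k 1"]
  by (simp add: matrix_vector_mult_basis column_def inner_axis')

lemma p_max_bounds:
  shows "0 \<le> p_max Nx Ny pt"
    and "\<lbrakk>i \<in> {1..Nx}; j \<in> {1..Ny}; b \<in> {1, 2}; g \<in> {1, 2}\<rbrakk>
      \<Longrightarrow> pt i j (gauss Nx i b, gauss Ny j g) \<le> p_max Nx Ny pt"
proof -
  let ?S = "{pt i j (gauss Nx i b, gauss Ny j g) | i j b g.
     i \<in> {1..Nx} \<and> j \<in> {1..Ny} \<and> b \<in> {1, 2} \<and> g \<in> {1, 2}}"
  have "?S \<subseteq> (\<lambda>(i, j, b, g). pt i j (gauss Nx i b, gauss Ny j g)) ` ({1..Nx} \<times> {1..Ny} \<times> {1, 2} \<times> {1, 2})"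
    by force
  then have "finite ?S"
    by (rule finite_subset) simp
  then have fin: "finite (insert 0 ?S)"
    by simp
  show "0 \<le> p_max Nx Ny pt"
    unfolding p_max_def by (intro Max_ge fin) simp
  show "\<lbrakk>i \<in> {1..Nx}; j \<in> {1..Ny}; b \<in> {1, 2}; g \<in> {1, 2}\<rbrakk>
      \<Longrightarrow> pt i j (gauss Nx i b, gauss Ny j g) \<le> p_max Nx Ny pt"
    unfolding p_max_def by (intro Max_ge fin) blast
qed

lemma q_neg_max_bounds:
  shows "0 \<le> q_neg_max Nx Ny q i j"
    and "\<lbrakk>b \<in> {1, 2}; g \<in> {1, 2}\<rbrakk> \<Longrightarrow> - q (gauss Nx i b, gauss Ny j g) \<le> q_neg_max Nx Ny q i j"
proof -
  let ?S = "{- q (gauss Nx i b, gauss Ny j g) | b g. b \<in> {1::nat, 2} \<and> g \<in> {1::nat, 2}}"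
  have fin: "finite (insert 0 ?S)"
    unfolding finite_insert by (rule finite_image_set2) auto
  show "0 \<le> q_neg_max Nx Ny q i j"
    unfolding q_neg_max_def by (intro Max_ge fin) simp
  show "\<lbrakk>b \<in> {1, 2}; g \<in> {1, 2}\<rbrakk> \<Longrightarrow> - q (gauss Nx i b, gauss Ny j g) \<le> q_neg_max Nx Ny q i j"
    unfolding q_neg_max_def by (intro Max_ge fin) blast
qed

lemma Phi_cell_min_pos:
  assumes "\<forall>z\<in>Omega. \<phi> z > 0" "i \<in> {1..Nx}" "j \<in> {1..Ny}"
  shows "0 < Phi_cell_min Nx Ny \<phi> i j"
proof -
  let ?S = "{Phi_node Nx Ny \<phi> k l | k l. k \<in> {i - 1, i} \<and> l \<in> {j - 1, j}}"
  have fin: "finite ?S"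
    by (rule finite_image_set2) auto
  have "?S \<noteq> {}" by auto
  moreover have "0 < x" if "x \<in> ?S" for x
    using that assms by (auto intro!: Phi_node_pos)
  ultimately show ?thesis
    unfolding Phi_cell_min_def using fin by (subst Min_gr_iff) auto
qed

text \<open>
  A fraction with denominator \<open>0\<close> is infinite and imposes no bound on \<open>t\<close>; the product form then only
  says \<open>0 \<le> P\<close>.
\<close>

lemma ereal_le_divideD:
  assumes "ereal t \<le> ereal P / ereal s" "0 \<le> s" "0 \<le> P"
  shows "t * s \<le> P"
  using assms by (cases "s = 0") (simp_all add: field_simps)

lemma B1_le:
  assumes "i \<in> {1..Nx - 1}" "j \<in> {1..Ny}" "b \<in> {1, 2}" "l \<in> {j - 1, j}"
  shows "B1 Nx Ny \<phi> \<alpha> u \<le> ereal (Phi_node Nx Ny \<phi> i l) / ereal (\<alpha> - u1_plus Nx Ny u i j b)"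
  unfolding B1_def
  by (rule INF_lower2[OF assms(1)], rule INF_lower2[OF assms(2)], rule INF_lower2[OF assms(3)],
      rule INF_lower[OF assms(4)])

lemma B2_le:
  assumes "i \<in> {1..Nx}" "j \<in> {1..Ny - 1}" "b \<in> {1, 2}" "k \<in> {i - 1, i}"
  shows "B2 Nx Ny \<phi> \<alpha> u \<le> ereal (Phi_node Nx Ny \<phi> k j) / ereal (\<alpha> - u2_plus Nx Ny u i j b)"
  unfolding B2_def
  by (rule INF_lower2[OF assms(1)], rule INF_lower2[OF assms(2)], rule INF_lower2[OF assms(3)],
      rule INF_lower[OF assms(4)])

lemma upwind_velocity_lt:
  assumes \<alpha>: "\<alpha> > Max (insert 0
           ({u1_plus Nx Ny u i j b | i j b. i \<in> {1..Nx - 1} \<and> j \<in> {1..Ny - 1} \<and> b \<in> {1, 2}}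
          \<union> {u2_plus Nx Ny u i j b | i j b. i \<in> {1..Nx - 1} \<and> j \<in> {1..Ny - 1} \<and> b \<in> {1, 2}}))"
    and "i \<in> {1..Nx - 1}" "j \<in> {1..Ny - 1}" "b \<in> {1, 2}"
  shows "u1_plus Nx Ny u i j b < \<alpha>" "u2_plus Nx Ny u i j b < \<alpha>"
proof -
  let ?S = "\<lambda>f :: nat \<Rightarrow> nat \<Rightarrow> nat \<Rightarrow> real. {f i j b | i j b. i \<in> {1..Nx - 1} \<and> j \<in> {1..Ny - 1} \<and> b \<in> {1, 2}}"
  have "?S f \<subseteq> (\<lambda>(i, j, b). f i j b) ` ({1..Nx - 1} \<times> {1..Ny - 1} \<times> {1, 2})" for f
    by force
  then have "finite (?S f)" for f
    by (rule finite_subset) simp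
  then have fin: "finite (insert 0 (?S (u1_plus Nx Ny u) \<union> ?S (u2_plus Nx Ny u)))"
    by (intro finite.insertI finite_UnI)
  show "u1_plus Nx Ny u i j b < \<alpha>"
    by (rule le_less_trans[OF Max_ge[OF fin] \<alpha>]) (use assms(2-) in blast)
  show "u2_plus Nx Ny u i j b < \<alpha>"
    by (rule le_less_trans[OF Max_ge[OF fin] \<alpha>]) (use assms(2-) in blast)
qed

lemma gauss_point_in_interior:
  assumes "i \<in> {1..Nx}" "j \<in> {1..Ny}"
  shows "(gauss Nx i b, gauss Ny j g) \<in> interior (cell Nx Ny i j)"
  using gauss_in_interval[of Nx i b] gauss_in_interval[of Ny j g] assms
  by (simp add: cell_def interior_Times)

theorem theorem3p3:
  fixes Nx Ny :: nat
    and \<phi> q ct \<kappa> :: "real \<times> real \<Rightarrow> real"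
    and \<mu> :: "real \<Rightarrow> real"
    and D :: "real \<times> real \<Rightarrow> real ^ 2 \<Rightarrow> real ^ 2 ^ 2"
    and z1 z2 \<alpha> \<alpha>' \<Delta>t \<Delta>x \<Delta>y lam \<Lambda>1 \<Lambda>2 :: real
    and p pt r r_next c :: "real cellfun"
    and u :: "(real ^ 2) cellfun"
  assumes "Nx \<ge> 1" and "Ny \<ge> 1"
    and "\<Delta>x = step Nx" and "\<Delta>y = step Ny" and "\<Delta>t > 0"
    and "lam = \<Delta>t / (\<Delta>x * \<Delta>y)" and "\<Lambda>1 = \<Delta>t / \<Delta>x\<^sup>2" and "\<Lambda>2 = \<Delta>t / \<Delta>y\<^sup>2"
    and "\<forall>z\<in>Omega. \<phi> z > 0" and "z1 > 0" and "z2 > 0" and "\<alpha> > 0" and "\<alpha>' > 0"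
    and "\<forall>z\<in>Omega. \<forall>v. transpose (D z v) = D z v \<and> (\<forall>w. w \<bullet> (D z v *v w) \<ge> 0)"
    and "p \<in> Wh Nx Ny" and "r \<in> Wh Nx Ny" and "u \<in> WWh Nx Ny"
    and "pt \<in> Wh Nx Ny" and "r_next \<in> Wh Nx Ny"
    and "c = conc Nx Ny \<phi> r"
    and "\<forall>z\<in>Omega. q z \<ge> 0 \<longrightarrow> 0 \<le> ct z \<and> ct z \<le> 1"
    and "\<forall>i\<in>{1..Nx}. \<forall>j\<in>{1..Ny}. \<forall>z\<in>interior (cell Nx Ny i j). q z < 0 \<longrightarrow> ct z = c i j z"
    and "pressure_eq Nx Ny \<phi> z1 z2 q r u pt"
    and "velocity_eq Nx Ny \<mu> \<kappa> c p u"
    and "conc_eq Nx Ny z1 q ct D \<alpha> \<alpha>' r c u pt (\<lambda>i j z. (r_next i j z - r i j z) / \<Delta>t)"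
    and "\<forall>i\<in>{1..Nx}. \<forall>j\<in>{1..Ny}. \<forall>z\<in>cell Nx Ny i j. r i j z > 0"
    and "\<alpha> > Max (insert 0
           ({u1_plus Nx Ny u i j b | i j b. i \<in> {1..Nx - 1} \<and> j \<in> {1..Ny - 1} \<and> b \<in> {1, 2}}
          \<union> {u2_plus Nx Ny u i j b | i j b. i \<in> {1..Nx - 1} \<and> j \<in> {1..Ny - 1} \<and> b \<in> {1, 2}}))"
    and "ereal \<alpha>' \<ge> ereal (\<Delta>y / (2 * \<Delta>x)) * D_diag_max Nx Ny D u 1
           + ereal (sqrt 3) * D_off_max Nx Ny D u 1 2"
    and "ereal \<alpha>' \<ge> ereal (\<Delta>x / (2 * \<Delta>y)) * D_diag_max Nx Ny D u 2
           + ereal (sqrt 3) * D_off_max Nx Ny D u 2 1"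
    and "ereal (\<Delta>t / \<Delta>x + \<Delta>t / \<Delta>y)
           \<le> ereal (1 / 6) * Min {ereal (Phi_min Nx Ny \<phi> / \<alpha>), B1 Nx Ny \<phi> \<alpha> u, B2 Nx Ny \<phi> \<alpha> u}"
    and "D_diag_max Nx Ny D u 1 * ereal \<Lambda>1 + 2 * (ereal \<alpha>' + D_off_max Nx Ny D u 1 2) * ereal lam
           \<le> ereal (1 / 12 * Phi_min Nx Ny \<phi>)"
    and "D_diag_max Nx Ny D u 2 * ereal \<Lambda>2 + 2 * (ereal \<alpha>' + D_off_max Nx Ny D u 2 1) * ereal lam
           \<le> ereal (1 / 12 * Phi_min Nx Ny \<phi>)"
    and "ereal \<Delta>t \<le> 1 / ereal (6 * z1 * p_max Nx Ny pt)"
    and "ereal \<Delta>t \<le> (INF i\<in>{1..Nx}. INF j\<in>{1..Ny}.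
           ereal (Phi_cell_min Nx Ny \<phi> i j) / ereal (6 * q_neg_max Nx Ny q i j))"
  shows "\<forall>i\<in>{2..Nx - 1}. \<forall>j\<in>{2..Ny - 1}. cell_avg Nx Ny r_next i j > 0"
proof -
  have pos: "\<Delta>x > 0" "\<Delta>y > 0" "lam > 0" "\<Lambda>1 > 0" "\<Lambda>2 > 0"
    using step_pos[of Nx] step_pos[of Ny] assms(1-8) by auto
  have mesh: "step Nx = \<Delta>x" "step Ny = \<Delta>y"
    using assms(3,4) by auto
  have diag_nonneg: "0 \<le> D z (u i j z) $ k $ k"
    if "i \<in> {1..Nx}" "j \<in> {1..Ny}" "z \<in> cell Nx Ny i j" for i j z k
    using cell_subset_Omega[OF that(1,2)] that(3) assms(14) by (blast intro: psd_diag_nonneg)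
  have cell11: "1 \<in> {1..Nx}" "1 \<in> {1..Ny}" "(node Nx 1, node Ny 1) \<in> cell Nx Ny 1 1"
    using assms(1,2) node_in_cell[of 1 Nx 1 Ny 1 1] by auto
  have max_nonneg: "0 \<le> D_diag_max Nx Ny D u k" "0 \<le> D_off_max Nx Ny D u k l" for k l
    using order_trans[OF _ D_diag_max_upper[OF cell11, of D u k], of 0] diag_nonneg[OF cell11]
      order_trans[OF _ D_off_max_upper[OF cell11, of D u k l], of 0] by auto
  obtain d1 a1 where x: "D_diag_max Nx Ny D u 1 = ereal d1" "D_off_max Nx Ny D u 1 2 = ereal a1"
    "0 \<le> d1" "0 \<le> a1" "\<Delta>y / (2 * \<Delta>x) * d1 + sqrt 3 * a1 \<le> \<alpha>'"
    "d1 * \<Lambda>1 + 2 * (\<alpha>' + a1) * lam \<le> 1 / 12 * Phi_min Nx Ny \<phi>"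
    using diffusion_constants[OF max_nonneg pos(4,3) assms(28,31)] by blast
  obtain d2 a2 where y: "D_diag_max Nx Ny D u 2 = ereal d2" "D_off_max Nx Ny D u 2 1 = ereal a2"
    "0 \<le> d2" "0 \<le> a2" "\<Delta>x / (2 * \<Delta>y) * d2 + sqrt 3 * a2 \<le> \<alpha>'"
    "d2 * \<Lambda>2 + 2 * (\<alpha>' + a2) * lam \<le> 1 / 12 * Phi_min Nx Ny \<phi>"
    using diffusion_constants[OF max_nonneg pos(5,3) assms(29,32)] by blast
  define d a :: "2 \<Rightarrow> real" where "d = (\<lambda>k. if k = 1 then d1 else d2)" and "a = (\<lambda>k. if k = 1 then a1 else a2)"
  interpret positive_state Nx Ny \<phi> r D u \<alpha> \<alpha>' d a
  proof
    fix i j z and k l :: 2 assume ijz: "i \<in> {1..Nx}" "j \<in> {1..Ny}" "z \<in> cell Nx Ny i j"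
    have "k = 1 \<or> k = 2" "l = 1 \<or> l = 2"
      using exhaust_2 by blast+
    then show "0 \<le> D z (u i j z) $ k $ k \<and> D z (u i j z) $ k $ k \<le> d k"
      using diag_nonneg[OF ijz] D_diag_max_upper[OF ijz, of D u k] x(1) y(1) by (auto simp: d_def)
    show "\<bar>D z (u i j z) $ k $ l\<bar> \<le> a k" if "k \<noteq> l"
      using D_off_max_upper[OF ijz, of D u k l] x(2) y(2) that \<open>k = 1 \<or> k = 2\<close> \<open>l = 1 \<or> l = 2\<close>
      by (auto simp: a_def)
  qed (use assms(9,12,16,26) x(3-5) y(3-5) mesh in \<open>simp_all add: d_def a_def\<close>)
  define T where "T = \<Delta>t / step Nx + \<Delta>t / step Ny"
  have min_le: "Min {x, y, z} \<le> x" "Min {x, y, z} \<le> y" "Min {x, y, z} \<le> z" for x y z :: ereal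
    by (simp_all add: min_le_iff_disj)
  have conv: "6 * T * s \<le> P"
    if "Min {ereal (Phi_min Nx Ny \<phi> / \<alpha>), B1 Nx Ny \<phi> \<alpha> u, B2 Nx Ny \<phi> \<alpha> u} \<le> ereal P / ereal s" "0 < s" for P s
  proof -
    have "ereal T \<le> ereal (1 / 6) * Min {ereal (Phi_min Nx Ny \<phi> / \<alpha>), B1 Nx Ny \<phi> \<alpha> u, B2 Nx Ny \<phi> \<alpha> u}"
      unfolding T_def mesh by (rule assms(30))
    also have "\<dots> \<le> ereal (1 / 6) * (ereal P / ereal s)"
      by (rule ereal_mult_left_mono[OF that(1)]) simp
    finally have "T \<le> P / (6 * s)"
      using that(2) by simp
    then show ?thesis
      using that(2) by (simp add: field_simps)
  qed
  have cfl_\<alpha>: "6 * T * \<alpha> \<le> Phi_min Nx Ny \<phi>"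
    using assms(12) min_le(1) by (intro conv) simp_all
  show ?thesis
  proof (intro ballI)
    fix i j assume "i \<in> {2..Nx - 1}" "j \<in> {2..Ny - 1}"
    then have i: "1 < i" "i < Nx" and j: "1 < j" "j < Ny"
      by auto
    then have ij: "i \<in> {1..Nx}" "j \<in> {1..Ny}" "i \<in> {1..Nx - 1}" "j \<in> {1..Ny - 1}"
      "i - 1 \<in> {1..Nx - 1}" "j - 1 \<in> {1..Ny - 1}"
      by auto
    show "cell_avg Nx Ny r_next i j > 0"
    proof (rule next_avg_pos[OF assms(25)[unfolded assms(20)] assms(19,5) i j T_def _ cfl_\<alpha>])
      show "u1_plus Nx Ny u i j b \<le> \<alpha> \<and> u2_plus Nx Ny u i j b \<le> \<alpha>" if "b \<in> {1, 2}" for b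
        using upwind_velocity_lt[OF assms(27) ij(3,4) that] by auto
      show "6 * T * (\<alpha> - u1_plus Nx Ny u (i - 1) j b) \<le> Phi_node Nx Ny \<phi> (i - 1) l"
        if "b \<in> {1, 2}" "l \<in> {j - 1, j}" for b l
        using upwind_velocity_lt[OF assms(27) ij(5,4) that(1)]
        by (intro conv[OF order_trans[OF min_le(2) B1_le[OF ij(5,2) that]]]) simp
      show "6 * T * (\<alpha> - u2_plus Nx Ny u i (j - 1) b) \<le> Phi_node Nx Ny \<phi> k (j - 1)"
        if "b \<in> {1, 2}" "k \<in> {i - 1, i}" for b k
        using upwind_velocity_lt[OF assms(27) ij(3,6) that(1)]
        by (intro conv[OF order_trans[OF min_le(3) B2_le[OF ij(1,6) that]]]) simp
      show "d 1 * (\<Delta>t / (step Nx)\<^sup>2) + 2 * (\<alpha>' + a 1) * (\<Delta>t / (step Nx * step Ny)) \<le> 1 / 12 * Phi_min Nx Ny \<phi>"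
        "d 2 * (\<Delta>t / (step Ny)\<^sup>2) + 2 * (\<alpha>' + a 2) * (\<Delta>t / (step Nx * step Ny)) \<le> 1 / 12 * Phi_min Nx Ny \<phi>"
        using x(6) y(6) unfolding d_def a_def mesh assms(6-8) by simp_all
    next
      fix b g :: nat assume bg: "b \<in> {1, 2}" "g \<in> {1, 2}"
      let ?z = "(gauss Nx i b, gauss Ny j g)"
      have z: "?z \<in> interior (cell Nx Ny i j)" "?z \<in> cell Nx Ny i j" "?z \<in> Omega"
        using gauss_point_in_interior[OF ij(1,2), of b g] interior_subset[of "cell Nx Ny i j"]
          cell_subset_Omega[OF ij(1,2)] by auto
      have r: "r i j ?z > 0"
        using r_pos[OF ij(1,2)] z(2) by blast
      have "ereal \<Delta>t \<le> ereal 1 / ereal (6 * z1 * p_max Nx Ny pt)"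
        using assms(33) by (simp add: one_ereal_def)
      then have "\<Delta>t * (6 * z1 * p_max Nx Ny pt) \<le> 1"
        using p_max_bounds(1)[of Nx Ny pt] assms(10) by (intro ereal_le_divideD) auto
      moreover have "\<Delta>t * (6 * z1 * pt i j ?z) \<le> \<Delta>t * (6 * z1 * p_max Nx Ny pt)"
        using p_max_bounds(2)[OF ij(1,2) bg] assms(5,10) by (intro mult_left_mono) auto
      ultimately have "\<Delta>t * (6 * z1 * pt i j ?z) * r i j ?z \<le> 1 * r i j ?z"
        using r by (intro mult_right_mono) auto
      then have compress: "\<Delta>t * (r i j ?z * z1 * pt i j ?z) \<le> r i j ?z / 6"
        by (simp add: mult_ac)
      \<comment> \<open>Where \<open>q < 0\<close>, the fluid leaves with the numerical concentration, which \<open>r\<close> controls.\<close>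
      have sink: "- (r i j ?z / 6) \<le> \<Delta>t * (ct ?z * q ?z)"
      proof (cases "q ?z \<ge> 0")
        case True
        then have "0 \<le> \<Delta>t * (ct ?z * q ?z)"
          using assms(5,21) z(3) by simp
        then show ?thesis
          using r by linarith
      next
        case False
        have "ereal \<Delta>t \<le> ereal (Phi_cell_min Nx Ny \<phi> i j) / ereal (6 * q_neg_max Nx Ny q i j)"
          using assms(34) by (rule order_trans) (rule INF_lower2[OF ij(1) INF_lower[OF ij(2)]])
        then have "\<Delta>t * (6 * q_neg_max Nx Ny q i j) \<le> Phi_cell_min Nx Ny \<phi> i j"
          using q_neg_max_bounds(1)[of Nx Ny q i j] Phi_cell_min_pos[OF assms(9) ij(1,2)]
          by (intro ereal_le_divideD) auto
        moreover have "\<Delta>t * (6 * - q ?z) \<le> \<Delta>t * (6 * q_neg_max Nx Ny q i j)"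
          using q_neg_max_bounds(2)[OF bg, of q Nx i Ny j] assms(5) by (intro mult_left_mono) auto
        ultimately have "\<Delta>t * (6 * - q ?z) \<le> Phi_cell_min Nx Ny \<phi> i j"
          by (rule order_trans[rotated])
        then have "\<Delta>t * (6 * - q ?z) * c i j ?z \<le> r i j ?z"
          unfolding assms(20)
          by (rule scaled_conc_le_cell[where i = i and j = j and r = r,
                OF assms(9,16) r_pos[OF ij(1,2)] ij(1,2) _ z(2)])
        moreover have "ct ?z = c i j ?z"
          using assms(22)[rule_format, OF ij(1,2) z(1)] False by simp
        ultimately show ?thesis
          by (simp add: algebra_simps)
      qed
      show "- (1 / 3) * r i j ?z \<le> \<Delta>t * (ct ?z * q ?z - r i j ?z * z1 * pt i j ?z)"
        using compress sink by (simp add: right_diff_distrib)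
    qed
  qed
qed

end
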